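(* Let $\lambda=(\lambda_1,\dots,\lambda_r)$ be a composition of $n$, let $k\in M(\lambda)$ and let $\overline{\lambda}=\lambda^{(k)}$. Let $d=s_{p+1}\cdots s_n$ and $\overline{d}=s_{q+1}\cdots s_n$, where $p=\sum_{1\le i\le k}\lambda_i$ and $q=\sum_{1\le i\le k-1}\lambda_i$ (so that $q=0$ when $k=1$). Let $\theta: Z(\lambda)\to Z(\overline{\lambda})$, $z\mapsto\overline z$, be the map defined by $\overline z=w_{D^{(k)}}$, where $D=D(z,\lambda)$. Then: (i) For each $z\in Z(\lambda)$ we have $z\theta\,(=\overline z)=dz$ (hence $\theta$ is injective). (ii) $\overline{d}\,\mathfrak{C}(\lambda)\subseteq\mathfrak{C}(\overline{\lambda})$. (iii) Any one of the conditions (a), (b) or (c) below is sufficient to ensure that $Y(\lambda)\theta\subseteq Y(\overline{\lambda})$: (a) $k=1$; (b) $k\ne\max M(\lambda)$; (c) $M(\lambda)=\{k\}$ and $\max\{i:\lambda_i=m\}>k$, where $m=\max\{\lambda_j: 1\le j\le r\text{ and }j\ne k\}$. Moreover, in case $k=1$, we have equality $Y(\lambda)\theta=Y(\overline{\lambda})$, and $\theta$ also induces a bijective mapping $\mathcal E^{(\lambda)}\to\mathcal E^{(\overline{\lambda})}$ in which $D\mapsto D^{(k)}$.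
   Context: Permutations. $S_n$ acts on $\{1,\dots,n\}$ on the right ($iw$ is the image of $i$ under $w$; $xy$ means first $x$, then $y$), and $S_n\subset S_{n+1}$ is the natural embedding (fixing $n+1$). $s_i=(i,i+1)$ and $l$ is the Coxeter length with respect to the $s_i$; empty products are $1$. An element $x$ is a prefix of $y$ if $l(y)=l(x)+l(x^{-1}y)$. Maps are written on the right. Right cells. The row-form of $w\in S_n$ is $[1w,2w,\dots,nw]$; $\mathcal P(w),\mathcal Q(w)$ are the insertion and recording tableaux obtained by Robinson–Schensted row insertion of the row-form. $\sim_R$ denotes the Kazhdan–Lusztig right cell equivalence; in $S_n$, $x\sim_R y$ if and only if $\mathcal Q(x)=\mathcal Q(y)$ (known theorem, may be taken as the definition). Compositions. Compositions have no zero parts. For $\lambda=(\lambda_1,\dots,\lambda_r)$ a composition of $n$: $J(\lambda)=\{s_1,\dots,s_{n-1}\}\setminus\{s_{\lambda_1},s_{\lambda_1+\lambda_2},\dots,s_{\lambda_1+\dots+\lambda_{r-1}}\}$; $w_{J(\lambda)}$ is the longest element of the parabolic subgroup $W_{J(\lambda)}=\langle J(\lambda)\rangle$; $\mathfrak X_{J(\lambda)}$ is the set of minimum length representatives of the right cosets of $W_{J(\lambda)}$ in $S_n$. Define $Z(\lambda)=\{e\in\mathfrak X_{J(\lambda)}: w_{J(\lambda)}e\sim_R w_{J(\lambda)}\}$, $Y(\lambda)=\{x\in Z(\lambda): x$ is not a prefix of any other $y\in Z(\lambda)\}$, and $\mathfrak C(\lambda)=w_{J(\lambda)}Z(\lambda)$,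 the right cell containing $w_{J(\lambda)}$; similarly for compositions of $n+1$ in $S_{n+1}$. $M(\lambda)=\{j: 1\le j\le r,\ \lambda_j=\max_i\lambda_i\}$, and for $k\in M(\lambda)$, $\lambda^{(k)}$ is the composition of $n+1$ with $r$ parts obtained from $\lambda$ by replacing $\lambda_k$ by $\lambda_k+1$. Diagrams. A (principal) diagram $D$ is a finite subset of $\mathbb Z^2$ whose nodes $(a,b)$ (row $a$, column $b$) have rows indexed $1,\dots,r_D$ and columns indexed $1,\dots,c_D$, with no empty row or column; $\lambda_D$ is its row-composition ($\lambda_{D,k}$ is the number of nodes in row $k$). $\mathcal D^{(\lambda)}$ is the set of principal diagrams $D$ with $\lambda_D=\lambda$. For $D$ with $n$ nodes, $t^D$ and $t_D$ are the bijections $D\to\{1,\dots,n\}$ obtained by filling in $1,\dots,n$ row by row (top to bottom, left to right) and column by column (left to right, top to bottom), respectively, and $w_D\in S_n$ is defined by $t^Dw_D=t_D$. For $d\in\mathfrak X_{J(\lambda)}$ there are diagrams $D\in\mathcal D^{(\lambda)}$ with $w_D=d$, and among them exactly one with the minimum number of columns; it is denoted $D(d,\lambda)$. Put $\mathcal E^{(\lambda)}=\{D(y,\lambda): y\in Y(\lambda)\}$. For $D\in\mathcal D^{(\lambda)}$ and $k\in M(\lambda)$, $D^{(k)}=D\cup\{(k,c_D+1)\}\in\mathcal D^{(\lambda^{(k)})}$. (For $z\in Z(\lambda)$ and $D=D(z,\lambda)$ it is known that $w_{D^{(k)}}\in Z(\lambda^{(k)})$, so $\theta$ is well defined.) *)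

theory Defs
  imports "HOL-Combinatorics.Transposition" "HOL-Combinatorics.Permutations"
    "HOL-Algebra.Coset" "HOL-Algebra.Generated_Groups"
begin

section \<open>Symmetric groups acting on the right\<close>

text \<open>A permutation of $\{1,\dots,n\}$ is a function satisfying \<open>w permutes {1..n}\<close>, so that the
  image of \<open>i\<close> under \<open>w\<close>, written $iw$ in right-action notation, is \<open>w i\<close>. Since such a function fixes
  all other points, the embedding of $S_n$ into $S_{n+1}$ is set inclusion.\<close>

text \<open>Products are read from left to right: first \<open>x\<close>, then \<open>y\<close>.\<close>

definition rmul :: "(nat \<Rightarrow> nat) \<Rightarrow> (nat \<Rightarrow> nat) \<Rightarrow> nat \<Rightarrow> nat" (infixl "\<cdot>" 70)
  where "x \<cdot> y = y \<circ> x"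

definition Sym :: "nat \<Rightarrow> (nat \<Rightarrow> nat) monoid"
  where "Sym n = \<lparr>carrier = {w. w permutes {1..n}}, mult = (\<cdot>), one = id\<rparr>"

definition s :: "nat \<Rightarrow> nat \<Rightarrow> nat"
  where "s i = transpose i (Suc i)"

fun word_prod :: "nat list \<Rightarrow> nat \<Rightarrow> nat"
  where
    "word_prod [] = id"
  | "word_prod (i # is) = s i \<cdot> word_prod is"

definition cox_length :: "nat \<Rightarrow> (nat \<Rightarrow> nat) \<Rightarrow> nat"
  where "cox_length n w = (LEAST m. \<exists>is. length is = m \<and> set is \<subseteq> {1..<n} \<and> word_prod is = w)"

definition is_prefix :: "nat \<Rightarrow> (nat \<Rightarrow> nat) \<Rightarrow> (nat \<Rightarrow> nat) \<Rightarrow> bool"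
  where "is_prefix n x y \<longleftrightarrow>
    cox_length n y = cox_length n x + cox_length n (Hilbert_Choice.inv x \<cdot> y)"

section \<open>Robinson--Schensted row insertion and right cells\<close>

text \<open>A tableau is the list of its rows. Inserting \<open>x\<close> into a row either appends it or replaces the
  leftmost entry exceeding \<open>x\<close>; the replaced entry is returned for insertion into the next row.\<close>

fun row_insert :: "nat \<Rightarrow> nat list \<Rightarrow> nat list \<times> nat option"
  where
    "row_insert x [] = ([x], None)"
  | "row_insert x (y # ys) =
      (if x < y then (x # ys, Some y)
       else (case row_insert x ys of (zs, b) \<Rightarrow> (y # zs, b)))"

text \<open>The second component of the result is the (0-based) index of the row that has grown.\<close>

fun tableau_insert :: "nat \<Rightarrow> nat list list \<Rightarrow> nat list list \<times> nat"
  where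
    "tableau_insert x [] = ([[x]], 0)"
  | "tableau_insert x (r # rs) =
      (case row_insert x r of
         (r', None) \<Rightarrow> (r' # rs, 0)
       | (r', Some y) \<Rightarrow> (case tableau_insert y rs of (rs', i) \<Rightarrow> (r' # rs', Suc i)))"

definition add_entry :: "nat \<Rightarrow> nat \<Rightarrow> nat list list \<Rightarrow> nat list list"
  where "add_entry i j T = (if i < length T then T[i := T ! i @ [j]] else T @ [[j]])"

fun RS_steps :: "nat \<Rightarrow> nat list \<Rightarrow> nat list list \<times> nat list list \<Rightarrow> nat list list \<times> nat list list"
  where
    "RS_steps j [] PQ = PQ"
  | "RS_steps j (x # xs) (P, Q) =
      (case tableau_insert x P of (P', i) \<Rightarrow> RS_steps (Suc j) xs (P', add_entry i j Q))"

definition row_form :: "nat \<Rightarrow> (nat \<Rightarrow> nat) \<Rightarrow> nat list"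
  where "row_form n w = map w [1..<Suc n]"

definition P_tableau :: "nat \<Rightarrow> (nat \<Rightarrow> nat) \<Rightarrow> nat list list"
  where "P_tableau n w = fst (RS_steps 1 (row_form n w) ([], []))"

definition Q_tableau :: "nat \<Rightarrow> (nat \<Rightarrow> nat) \<Rightarrow> nat list list"
  where "Q_tableau n w = snd (RS_steps 1 (row_form n w) ([], []))"

text \<open>The Kazhdan--Lusztig right cell equivalence on $S_n$, defined by its description through
  recording tableaux.\<close>

definition right_cell_equiv :: "nat \<Rightarrow> (nat \<Rightarrow> nat) \<Rightarrow> (nat \<Rightarrow> nat) \<Rightarrow> bool"
  where "right_cell_equiv n x y \<longleftrightarrow> Q_tableau n x = Q_tableau n y"

section \<open>Compositions\<close>

text \<open>In all the definitions indexed by a composition \<open>lam\<close>, the ambient symmetric group is $S_n$ with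
  \<open>n = sum_list lam\<close>. Parts are numbered from 1, so the \<open>j\<close>-th part is \<open>lam ! (j - 1)\<close>.\<close>

definition composition_of :: "nat list \<Rightarrow> nat \<Rightarrow> bool"
  where "composition_of lam n \<longleftrightarrow> 0 \<notin> set lam \<and> sum_list lam = n"

definition J :: "nat list \<Rightarrow> (nat \<Rightarrow> nat) set"
  where "J lam = s ` {1..<sum_list lam} - {s (sum_list (take i lam)) | i. 1 \<le> i \<and> i < length lam}"

definition W_J :: "nat list \<Rightarrow> (nat \<Rightarrow> nat) set"
  where "W_J lam = generate (Sym (sum_list lam)) (J lam)"

definition w_J :: "nat list \<Rightarrow> nat \<Rightarrow> nat"
  where "w_J lam = (THE w. w \<in> W_J lam \<and>
    (\<forall>v\<in>W_J lam. cox_length (sum_list lam) v \<le> cox_length (sum_list lam) w))"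

definition X_J :: "nat list \<Rightarrow> (nat \<Rightarrow> nat) set"
  where "X_J lam = {e \<in> carrier (Sym (sum_list lam)).
    \<forall>x \<in> W_J lam #>\<^bsub>Sym (sum_list lam)\<^esub> e.
      cox_length (sum_list lam) e \<le> cox_length (sum_list lam) x}"

definition Z :: "nat list \<Rightarrow> (nat \<Rightarrow> nat) set"
  where "Z lam = {e \<in> X_J lam. right_cell_equiv (sum_list lam) (w_J lam \<cdot> e) (w_J lam)}"

definition Y :: "nat list \<Rightarrow> (nat \<Rightarrow> nat) set"
  where "Y lam = {x \<in> Z lam. \<forall>y\<in>Z lam. y \<noteq> x \<longrightarrow> \<not> is_prefix (sum_list lam) x y}"

definition C_cell :: "nat list \<Rightarrow> (nat \<Rightarrow> nat) set"
  where "C_cell lam = (\<lambda>e. w_J lam \<cdot> e) ` Z lam"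

definition M :: "nat list \<Rightarrow> nat set"
  where "M lam = {j. 1 \<le> j \<and> j \<le> length lam \<and> lam ! (j - 1) = Max (set lam)}"

definition inc_part :: "nat list \<Rightarrow> nat \<Rightarrow> nat list"
  where "inc_part lam k = lam[k - 1 := Suc (lam ! (k - 1))]"

section \<open>Diagrams\<close>

text \<open>A node is a pair (row, column). Rows and columns of a principal diagram are numbered from 1, so
  natural number coordinates suffice.\<close>

type_synonym diagram = "(nat \<times> nat) set"

definition is_diagram :: "diagram \<Rightarrow> bool"
  where "is_diagram D \<longleftrightarrow> finite D \<and> (\<exists>r c. fst ` D = {1..r} \<and> snd ` D = {1..c})"

definition num_rows :: "diagram \<Rightarrow> nat"
  where "num_rows D = card (fst ` D)"

definition num_cols :: "diagram \<Rightarrow> nat"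
  where "num_cols D = card (snd ` D)"

definition row_composition :: "diagram \<Rightarrow> nat list"
  where "row_composition D = map (\<lambda>k. card {x \<in> D. fst x = k}) [1..<Suc (num_rows D)]"

definition diagrams :: "nat list \<Rightarrow> diagram set"
  where "diagrams lam = {D. is_diagram D \<and> row_composition D = lam}"

text \<open>The entry of a node in the row-by-row (column-by-column) filling is the number of nodes up to
  and including it in the corresponding reading order.\<close>

definition row_filling :: "diagram \<Rightarrow> nat \<times> nat \<Rightarrow> nat"
  where "row_filling D x =
    card {y \<in> D. fst y < fst x \<or> fst y = fst x \<and> snd y \<le> snd x}"

definition col_filling :: "diagram \<Rightarrow> nat \<times> nat \<Rightarrow> nat"
  where "col_filling D x =
    card {y \<in> D. snd y < snd x \<or> snd y = snd x \<and> fst y \<le> fst x}"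

definition w_diag :: "diagram \<Rightarrow> nat \<Rightarrow> nat"
  where "w_diag D = (THE w. w permutes {1..card D} \<and> (\<forall>x\<in>D. w (row_filling D x) = col_filling D x))"

definition min_diagram :: "(nat \<Rightarrow> nat) \<Rightarrow> nat list \<Rightarrow> diagram"
  where "min_diagram d lam = (THE D. D \<in> diagrams lam \<and> w_diag D = d \<and>
    (\<forall>E\<in>diagrams lam. w_diag E = d \<longrightarrow> num_cols D \<le> num_cols E))"

definition E_diagrams :: "nat list \<Rightarrow> diagram set"
  where "E_diagrams lam = (\<lambda>y. min_diagram y lam) ` Y lam"

definition extend_diagram :: "nat \<Rightarrow> diagram \<Rightarrow> diagram"
  where "extend_diagram k D = D \<union> {(k, num_cols D + 1)}"

definition theta :: "nat list \<Rightarrow> nat \<Rightarrow> (nat \<Rightarrow> nat) \<Rightarrow> nat \<Rightarrow> nat"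
  where "theta lam k z = w_diag (extend_diagram k (min_diagram z lam))"

end

theory Submission
  imports Defs
begin

text \<open>
  Write a permutation whose row-form decreases on the blocks of \<open>lam\<close> as $w_{J}e$. Its recording
  tableau is determined by the sequence of rows that grow during the insertion, and $e \in Z(\lambda)$
  means that within every block of length $l$ the rows $0,1,\dots,l-1$ grow in this order.
  Multiplying by $d$ puts the letter $n+1$ in front of block $k$ of $w_{J}e$. This letter never
  influences the smaller ones: it sits at the end of a row and moves to the next row exactly when its
  row grows. Hence the growth sequence with $n+1$ is a function of the one without it; since no block
  is longer than block $k$, the canonical sequence for \<open>lam\<close> goes to that for \<open>lam'\<close>.

  For maximality let $dy$ be a prefix of $v \in Z(\overline\lambda)$, that is, let the inversions of
  $dy$ be inversions of $v$. The end of block $k$ in $v$ then dominates everything to its right, and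
  as a row ending in $n+1$ cannot grow without moving it, $n+1$ lies in block $k$ also for $v$, so
  $v = dy'$. After block $k$ the letter $n+1$ is in some row at least as low as every later block is
  long; each of (a), (b), (c) makes some later block as long as all earlier ones (or makes $k$ the
  first block), which forces $n+1$ into the last row, and then $y' \in Z(\lambda)$.

  If $k = 1$ the first letter of $w_{\overline J}v$ always ends up alone in the last row, so it can be
  replaced by the largest letter; this lengthens $v$ unless it is $n+1$ already.

  A diagram is an assignment of columns to the values $1,\dots,n$, weakly increasing and strictly
  increasing from $j$ to $j+1$ unless the row goes up; the greedy assignment is the one with the
  fewest columns, and for $k = 1$ the value $n+1$ always needs a new column.
\<close>

section \<open>Growth sequences of row insertion\<close>

declare upt_Suc [simp del]

fun insert_word :: "nat list \<Rightarrow> nat list list \<Rightarrow> nat list list"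
  where
    "insert_word [] T = T"
  | "insert_word (x # xs) T = insert_word xs (fst (tableau_insert x T))"

fun growth :: "nat list \<Rightarrow> nat list list \<Rightarrow> nat list"
  where
    "growth [] T = []"
  | "growth (x # xs) T = snd (tableau_insert x T) # growth xs (fst (tableau_insert x T))"

lemma insert_word_append: "insert_word (xs @ ys) T = insert_word ys (insert_word xs T)"
  by (induction xs arbitrary: T) auto

lemma growth_append: "growth (xs @ ys) T = growth xs T @ growth ys (insert_word xs T)"
  by (induction xs arbitrary: T) auto

lemma length_growth [simp]: "length (growth xs T) = length xs"
  by (induction xs arbitrary: T) auto

lemma row_insert_set:
  "row_insert x r = (r', b) \<Longrightarrow> set r' \<union> set_option b = insert x (set r)"
proof (induction r arbitrary: r' b)
  case (Cons y r)
  show ?case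
  proof (cases "x < y")
    case True
    then show ?thesis using Cons.prems by auto
  next
    case False
    obtain zs c where zs: "row_insert x r = (zs, c)" by fastforce
    then have "r' = y # zs" "b = c" using Cons.prems False by auto
    moreover have "set zs \<union> set_option c = insert x (set r)" using Cons.IH zs by simp
    ultimately show ?thesis by auto
  qed
qed auto

lemma tableau_insert_set:
  "set (concat (fst (tableau_insert x T))) = insert x (set (concat T))"
proof (induction T arbitrary: x)
  case (Cons r rs)
  obtain r' b where b: "row_insert x r = (r', b)" by fastforce
  note set = row_insert_set[OF b]
  show ?case
  proof (cases b)
    case None
    then show ?thesis using set b by auto
  next
    case (Some y)
    have "set (concat (fst (tableau_insert x (r # rs)))) =
      set r' \<union> set (concat (fst (tableau_insert y rs)))"
      using b Some by (simp split: prod.splits)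
    also have "\<dots> = (set r' \<union> set_option b) \<union> set (concat rs)"
      unfolding Cons.IH using Some by auto
    finally show ?thesis using set by auto
  qed
qed simp

lemma insert_word_set:
  "set (concat (insert_word xs T)) = set xs \<union> set (concat T)"
proof (induction xs arbitrary: T)
  case (Cons x xs)
  show ?case using Cons.IH[of "fst (tableau_insert x T)"] tableau_insert_set[of x T]
    by (simp del: set_concat)
qed simp

lemma tableau_insert_snd_le: "snd (tableau_insert x T) \<le> length T"
proof (induction T arbitrary: x)
  case (Cons r rs)
  show ?case
  proof (cases "snd (row_insert x r)")
    case None
    then show ?thesis by (auto split: prod.splits)
  next
    case (Some y)
    then show ?thesis using Cons.IH[of y] by (auto split: prod.splits)
  qed
qed simp

lemma length_tableau_insert:
  "length (fst (tableau_insert x T)) = max (length T) (Suc (snd (tableau_insert x T)))"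
proof (induction T arbitrary: x)
  case (Cons r rs)
  show ?case
  proof (cases "snd (row_insert x r)")
    case None
    then show ?thesis by (auto split: prod.splits)
  next
    case (Some y)
    then show ?thesis using Cons.IH[of y] by (auto split: prod.splits)
  qed
qed simp

lemma length_insert_word_le:
  assumes "\<forall>g\<in>set (growth xs T). g < b" "length T \<le> b"
  shows "length (insert_word xs T) \<le> b"
  using assms by (induction xs arbitrary: T) (auto simp: length_tableau_insert)

lemma length_add_entry: "i \<le> length T \<Longrightarrow> length (add_entry i j T) = max (length T) (Suc i)"
  by (auto simp: add_entry_def)

section \<open>Recording tableaux and growth sequences\<close>

fun add_entries :: "nat \<Rightarrow> nat list \<Rightarrow> nat list list \<Rightarrow> nat list list"
  where
    "add_entries j [] T = T"
  | "add_entries j (g # gs) T = add_entries (Suc j) gs (add_entry g j T)"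

lemma RS_steps_eq: "RS_steps j xs (P, Q) = (insert_word xs P, add_entries j (growth xs P) Q)"
  by (induction xs arbitrary: j P Q) (auto split: prod.splits)

text \<open>Locates a label in a recording tableau; this is how the row that grew at step
  \<open>j\<close> is recovered.\<close>

definition rows_with :: "nat \<Rightarrow> nat list list \<Rightarrow> nat set"
  where "rows_with j T = {i. i < length T \<and> j \<in> set (T ! i)}"

lemma rows_with_add_entry_other: "j \<noteq> j' \<Longrightarrow> rows_with j (add_entry i j' T) = rows_with j T"
  by (auto simp: rows_with_def add_entry_def nth_append nth_list_update split: if_splits)

lemma rows_with_add_entry_new:
  "\<lbrakk>rows_with j T = {}; i \<le> length T\<rbrakk> \<Longrightarrow> rows_with j (add_entry i j T) = {i}"
  by (auto simp: rows_with_def add_entry_def nth_append nth_list_update split: if_splits)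

lemma rows_with_add_entries: "j < j' \<Longrightarrow> rows_with j (add_entries j' gs T) = rows_with j T"
  by (induction gs arbitrary: j' T) (auto simp: rows_with_add_entry_other)

text \<open>The label \<open>j\<close> goes into the row that grows at step \<open>j\<close>, and
  all later labels are larger, so the row holding \<open>j\<close> in the final tableau reveals that
  growth index. Induction over the word compares one step at a time.\<close>

lemma growth_eq_if_add_entries_eq:
  assumes "length xs = length xs'" "length P = length Q" "length P' = length Q"
    and "\<forall>i\<ge>j. rows_with i Q = {}"
    and "add_entries j (growth xs P) Q = add_entries j (growth xs' P') Q"
  shows "growth xs P = growth xs' P'"
  using assms
proof (induction xs arbitrary: xs' j P P' Q)
  case (Cons x xs)
  then obtain x' ys where xs': "xs' = x' # ys" by (cases xs') auto
  let ?g = "snd (tableau_insert x P)" and ?g' = "snd (tableau_insert x' P')"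
  have g: "?g \<le> length Q" "?g' \<le> length Q"
    using tableau_insert_snd_le Cons.prems(2,3) by metis+
  have eq: "add_entries (Suc j) (growth xs (fst (tableau_insert x P))) (add_entry ?g j Q)
     = add_entries (Suc j) (growth ys (fst (tableau_insert x' P'))) (add_entry ?g' j Q)"
    using Cons.prems(5) xs' by simp
  then have "rows_with j (add_entry ?g j Q) = rows_with j (add_entry ?g' j Q)"
    by (metis rows_with_add_entries lessI)
  then have gg: "?g = ?g'" using rows_with_add_entry_new g Cons.prems(4) by auto
  have "growth xs (fst (tableau_insert x P)) = growth ys (fst (tableau_insert x' P'))"
  proof (rule Cons.IH)
    show "add_entries (Suc j) (growth xs (fst (tableau_insert x P))) (add_entry ?g j Q)
     = add_entries (Suc j) (growth ys (fst (tableau_insert x' P'))) (add_entry ?g j Q)"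
      using eq gg by simp
    show "\<forall>i\<ge>Suc j. rows_with i (add_entry ?g j Q) = {}"
      using Cons.prems(4) by (auto simp: rows_with_add_entry_other)
  qed (use Cons.prems xs' g gg in \<open>auto simp: length_tableau_insert length_add_entry\<close>)
  then show ?case using gg xs' by simp
qed simp

text \<open>Trades the cell relation for an equality of lists of row indices; later arguments about
  cells work with growth sequences only.\<close>

lemma right_cell_equiv_iff:
  "right_cell_equiv n x y \<longleftrightarrow> growth (row_form n x) [] = growth (row_form n y) []"
proof -
  have "length (row_form n x) = length (row_form n y)" by (simp add: row_form_def)
  then show ?thesis
    using growth_eq_if_add_entries_eq[of "row_form n x" "row_form n y" "[]" "[]" "[]" 1]
    by (auto simp: right_cell_equiv_def Q_tableau_def RS_steps_eq rows_with_def)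
qed

text \<open>Adding a letter larger than all others to a word does not disturb the other letters: it sits
  at the end of its row \<open>a\<close> until that row grows, and then moves to the next row.\<close>

fun bump_track :: "nat \<Rightarrow> nat list \<Rightarrow> nat list"
  where
    "bump_track a [] = []"
  | "bump_track a (g # gs) = (if g = a then Suc a # bump_track (Suc a) gs else g # bump_track a gs)"

text \<open>If \<open>x\<close> would have been appended to \<open>r\<close>, then \<open>N\<close>
  is the leftmost entry exceeding it and gets bumped; otherwise an entry of \<open>r\<close> is
  bumped and \<open>N\<close> stays last.\<close>

lemma row_insert_append_large:
  assumes "x < N" "row_insert x r = (r', b)"
  shows "row_insert x (r @ [N]) = (case b of None \<Rightarrow> (r', Some N) | Some y \<Rightarrow> (r' @ [N], Some y))"
  using assms by (induction r arbitrary: r' b) (auto split: if_splits prod.splits option.splits)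

lemma row_insert_large: "\<forall>y\<in>set r. y < N \<Longrightarrow> row_insert N r = (r @ [N], None)"
  by (induction r) auto

lemma tableau_insert_large:
  "\<forall>y\<in>set (concat T). y < N \<Longrightarrow> tableau_insert N T = (add_entry 0 N T, 0)"
  by (cases T) (auto simp: add_entry_def row_insert_large)

lemma add_entry_Cons: "add_entry (Suc i) j (r # rs) = r # add_entry i j rs"
  by (auto simp: add_entry_def)

lemma add_entry_0_Cons: "add_entry 0 j (r # rs) = (r @ [j]) # rs"
  by (auto simp: add_entry_def)

text \<open>Growth of row \<open>a\<close> bumps \<open>N\<close> into the next row, where it is
  appended because it exceeds every entry. The value \<open>a = length T\<close> is allowed and
  means that \<open>N\<close> forms a row of its own.\<close>

lemma tableau_insert_add_entry:
  assumes "x < N" "\<forall>y\<in>set (concat T). y < N" "a \<le> length T" "tableau_insert x T = (T', g)"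
  shows "tableau_insert x (add_entry a N T) =
    (if g = a then (add_entry (Suc a) N T', Suc a) else (add_entry a N T', g))"
  using assms
proof (induction T arbitrary: x a T' g)
  case Nil
  then show ?case by (auto simp: add_entry_def)
next
  case (Cons r rs)
  obtain r' b where b: "row_insert x r = (r', b)" by fastforce
  note set = row_insert_set[OF b]
  show ?case
  proof (cases a)
    case 0
    show ?thesis
    proof (cases b)
      case None
      then show ?thesis using b Cons.prems 0
        by (auto simp: add_entry_0_Cons add_entry_Cons row_insert_append_large tableau_insert_large)
    next
      case (Some y)
      then show ?thesis using b Cons.prems 0
        by (auto simp: add_entry_0_Cons row_insert_append_large split: prod.splits)
    qed
  next
    case (Suc a')
    show ?thesis
    proof (cases b)
      case None
      then show ?thesis using b Cons.prems Suc by (auto simp: add_entry_Cons)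
    next
      case (Some y)
      obtain rs' g' where g': "tableau_insert y rs = (rs', g')" by fastforce
      have "y < N" using set Some Cons.prems by auto
      then have "tableau_insert y (add_entry a' N rs) =
        (if g' = a' then (add_entry (Suc a') N rs', Suc a') else (add_entry a' N rs', g'))"
        using Cons.IH Cons.prems Suc g' by auto
      then show ?thesis using b Some g' Cons.prems Suc by (auto simp: add_entry_Cons)
    qed
  qed
qed

lemma growth_add_entry:
  assumes "\<forall>y\<in>set xs \<union> set (concat T). y < N" "a \<le> length T"
  shows "growth xs (add_entry a N T) = bump_track a (growth xs T)"
  using assms
proof (induction xs arbitrary: T a)
  case (Cons x xs)
  obtain T' g where g: "tableau_insert x T = (T', g)" by fastforce
  have T': "\<forall>y\<in>set xs \<union> set (concat T'). y < N"
    using Cons.prems(1) tableau_insert_set[of x T] g by auto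
  have "length T' = max (length T) (Suc g)" using length_tableau_insert[of x T] g by simp
  then have le: "a \<le> length T'" "g = a \<Longrightarrow> Suc a \<le> length T'" using Cons.prems by auto
  have "tableau_insert x (add_entry a N T) =
    (if g = a then (add_entry (Suc a) N T', Suc a) else (add_entry a N T', g))"
    using tableau_insert_add_entry[of x N T a] Cons.prems g by auto
  then show ?case using Cons.IH[OF T'] le g by auto
qed simp

lemma growth_large_Cons:
  assumes "\<forall>y\<in>set xs \<union> set (concat T). y < N"
  shows "growth (N # xs) T = 0 # bump_track 0 (growth xs T)"
proof -
  have "tableau_insert N T = (add_entry 0 N T, 0)" using assms by (intro tableau_insert_large) auto
  then show ?thesis using growth_add_entry[OF assms] by simp
qed

text \<open>The growth sequence of \<open>w_J lam\<close> itself, hence of every element of its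
  right cell.\<close>

definition canonical :: "nat list \<Rightarrow> nat list"
  where "canonical lam = concat (map (\<lambda>l. [0..<l]) lam)"

lemma canonical_simps [simp]:
  "canonical [] = []" "canonical (l # ls) = [0..<l] @ canonical ls"
  "canonical (ks @ ls) = canonical ks @ canonical ls"
  by (auto simp: canonical_def)

lemma set_canonical: "set (canonical lam) = (\<Union>l\<in>set lam. {0..<l})"
  by (auto simp: canonical_def)

lemma length_canonical [simp]: "length (canonical lam) = sum_list lam"
  by (induction lam) auto

lemma bump_track_notin: "a \<notin> set gs \<Longrightarrow> bump_track a gs = gs"
  by (induction gs) auto

text \<open>Each step of an increasing run starting at \<open>a\<close> meets the largest letter and
  pushes it one row further, so it ends in row \<open>l\<close>.\<close>

lemma bump_track_upt: "a \<le> l \<Longrightarrow> bump_track a ([a..<l] @ gs) = [Suc a..<Suc l] @ bump_track l gs"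
proof (induction "l - a" arbitrary: a)
  case (Suc d)
  then have "a < l" by linarith
  then have "[a..<l] = a # [Suc a..<l]" "[Suc a..<Suc l] = Suc a # [Suc (Suc a)..<Suc l]"
    by (auto intro: upt_conv_Cons)
  then show ?case using Suc \<open>a < l\<close> by simp
qed simp

text \<open>Row \<open>a\<close> cannot grow while it ends in the largest letter.\<close>

lemma bump_track_member: "bump_track a gs = xs @ a # ys \<Longrightarrow> Suc a \<in> set xs"
proof (induction gs arbitrary: xs)
  case (Cons g gs)
  then show ?case by (cases xs) (auto split: if_splits)
qed simp

text \<open>The letter leaves row \<open>a\<close> only through an output \<open>Suc a\<close>;
  without one it never moves.\<close>

lemma bump_track_id: "Suc a \<notin> set (bump_track a gs) \<Longrightarrow> bump_track a gs = gs"
  by (induction gs) (auto split: if_splits)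

text \<open>A block longer than \<open>a\<close> outputs \<open>a\<close>, which requires an earlier
  output \<open>Suc a\<close>. But everything before it, namely \<open>ds\<close> and the start of
  the block, is at most \<open>a\<close>. The prefix \<open>ds\<close> collects the blocks already
  treated.\<close>

lemma bump_track_parts_le:
  assumes "bump_track a gs = ds @ canonical ps" "\<forall>x\<in>set ds. x \<le> a"
  shows "\<forall>l\<in>set ps. l \<le> a"
  using assms
proof (induction ps arbitrary: ds)
  case (Cons l ps)
  have le: "l \<le> a"
  proof (rule ccontr)
    assume "\<not> l \<le> a"
    then have "[0..<l] = [0..<a] @ a # [Suc a..<l]"
      using upt_add_eq_append[of 0 a "l - a"] by (simp add: upt_conv_Cons)
    then have "bump_track a gs = (ds @ [0..<a]) @ a # [Suc a..<l] @ canonical ps"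
      using Cons.prems by simp
    then have "Suc a \<in> set (ds @ [0..<a])" by (rule bump_track_member)
    then show False using Cons.prems by auto
  qed
  have "\<forall>l\<in>set ps. l \<le> a"
    by (rule Cons.IH[of "ds @ [0..<l]"]) (use Cons.prems le in auto)
  then show ?case using le by simp
qed simp

text \<open>Moving the letter outputs \<open>Suc a\<close>, so larger outputs are plain copies of
  the input.\<close>

lemma bump_track_skip:
  assumes "bump_track a gs = ds @ cs" "\<forall>x\<in>set ds. Suc a < x"
  shows "\<exists>gs'. gs = ds @ gs' \<and> bump_track a gs' = cs"
  using assms
proof (induction ds arbitrary: gs)
  case (Cons x ds)
  then obtain g gs' where "gs = g # gs'" by (cases gs) auto
  then show ?case using Cons by (auto split: if_splits)
qed simp

text \<open>An output \<open>Suc b\<close> arises in two ways: row \<open>b\<close> grew and pushed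
  the letter down, or row \<open>Suc b\<close> itself grew. In the second case the rest of the run
  is larger and therefore copied. The witness \<open>a\<close> is the row where the pushing
  stops.\<close>

lemma bump_track_upt_inverse:
  assumes "bump_track b gs = [Suc b..<Suc m] @ cs" "b \<le> m"
  shows "\<exists>a gs'. b \<le> a \<and> a \<le> m \<and> gs = [b..<a] @ [Suc a..<Suc m] @ gs' \<and> bump_track a gs' = cs"
  using assms
proof (induction "m - b" arbitrary: b gs)
  case 0
  then show ?case by (intro exI[of _ b] exI[of _ gs]) auto
next
  case (Suc d)
  then have up: "[Suc b..<Suc m] = Suc b # [Suc (Suc b)..<Suc m]" by (intro upt_conv_Cons) linarith
  then obtain g gs1 where g: "gs = g # gs1" using Suc.prems by (cases gs) auto
  show ?case
  proof (cases "g = b")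
    case True
    then have gs1: "bump_track (Suc b) gs1 = [Suc (Suc b)..<Suc m] @ cs"
      using Suc.prems up g by simp
    have d: "d = m - Suc b" "Suc b \<le> m" using Suc.hyps(2) by linarith+
    obtain a gs' where a: "Suc b \<le> a" "a \<le> m"
      "gs1 = [Suc b..<a] @ [Suc a..<Suc m] @ gs'" "bump_track a gs' = cs"
      using Suc.hyps(1)[OF d(1) gs1 d(2)] by blast
    then have "gs = [b..<a] @ [Suc a..<Suc m] @ gs'" using g True by (simp add: upt_conv_Cons)
    moreover have "b \<le> a" using a by simp
    ultimately show ?thesis using a by blast
  next
    case False
    then have "g = Suc b" "bump_track b gs1 = [Suc (Suc b)..<Suc m] @ cs" using Suc.prems up g by auto
    then obtain gs' where "gs1 = [Suc (Suc b)..<Suc m] @ gs'" "bump_track b gs' = cs"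
      using bump_track_skip[of b gs1 "[Suc (Suc b)..<Suc m]" cs] by auto
    then show ?thesis using g \<open>g = Suc b\<close> up Suc.hyps(2)
      by (intro exI[of _ b] exI[of _ gs']) auto
  qed
qed

text \<open>After the first block the letter rests in row \<open>a\<close>. The later parts are then
  at most \<open>a\<close>, so \<open>Suc a\<close> never appears again and the remaining growth is
  copied.\<close>

lemma bump_track_canonical_inverse:
  assumes "bump_track 0 gs = [Suc 0..<Suc m] @ canonical ps"
  shows "\<exists>a\<le>m. gs = [0..<a] @ [Suc a..<Suc m] @ canonical ps \<and> (\<forall>l\<in>set ps. l \<le> a)"
proof -
  obtain a gs' where a: "a \<le> m" "gs = [0..<a] @ [Suc a..<Suc m] @ gs'"
      "bump_track a gs' = canonical ps"
    using bump_track_upt_inverse[OF assms] by auto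
  have le: "\<forall>l\<in>set ps. l \<le> a" using bump_track_parts_le[of a gs' "[]" ps] a by auto
  then have "Suc a \<notin> set (bump_track a gs')" using a by (auto simp: set_canonical)
  then have "gs' = canonical ps" using bump_track_id a by metis
  then show ?thesis using a le by auto
qed

text \<open>The first block pushes the letter down to row \<open>m\<close>; later parts are at most
  \<open>m\<close> and only grow rows above it.\<close>

lemma bump_track_canonical:
  assumes "\<forall>l\<in>set ps. l \<le> m"
  shows "0 # bump_track 0 ([0..<m] @ canonical ps) = [0..<Suc m] @ canonical ps"
proof -
  have "m \<notin> set (canonical ps)" using assms by (auto simp: set_canonical)
  then show ?thesis using bump_track_upt[of 0 m "canonical ps"]
    by (simp add: bump_track_notin upt_conv_Cons)
qed

text \<open>Let \<open>a\<close> be the row where \<open>N\<close> rests after its block. Later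
  parts are at most \<open>a\<close>, hence at most \<open>m\<close>. A bound \<open>R\<close> on
  the earlier parts that some later part reaches also satisfies \<open>R \<le> a\<close>. If
  \<open>a < m\<close>, the word without \<open>N\<close> would grow row \<open>Suc a\<close> when
  at most \<open>a\<close> rows exist; so \<open>a = m\<close>, and deleting \<open>N\<close>
  shortens just its own block.\<close>

lemma growth_remove_large:
  assumes large: "\<forall>y\<in>set us \<union> set ws. y < N"
    and gr: "growth (us @ N # ws) [] = canonical (ks @ Suc m # ls)"
    and len: "length us = sum_list ks"
  shows "\<forall>l\<in>set ls. l \<le> m"
    and "\<forall>l\<in>set ks. l \<le> R \<Longrightarrow> R = 0 \<or> (\<exists>l\<in>set ls. R \<le> l) \<Longrightarrow>
      growth (us @ ws) [] = canonical (ks @ m # ls)"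
proof -
  let ?T = "insert_word us []"
  let ?G = "growth ws ?T"
  have "set (concat ?T) = set us" using insert_word_set[of us "[]"] by simp
  then have "growth (us @ N # ws) [] = growth us [] @ 0 # bump_track 0 ?G"
    using growth_large_Cons[of ws ?T N] large by (simp add: growth_append Un_commute del: growth.simps(2) set_concat)
  moreover have "canonical (ks @ Suc m # ls) = canonical ks @ 0 # [Suc 0..<Suc m] @ canonical ls"
    by (simp add: upt_conv_Cons)
  ultimately have eq: "growth us [] = canonical ks" "bump_track 0 ?G = [Suc 0..<Suc m] @ canonical ls"
    using gr len by (auto simp: append_eq_append_conv)
  obtain a where a: "a \<le> m" "?G = [0..<a] @ [Suc a..<Suc m] @ canonical ls" "\<forall>l\<in>set ls. l \<le> a"
    using bump_track_canonical_inverse[OF eq(2)] by auto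
  show "\<forall>l\<in>set ls. l \<le> m" using a by auto
  assume R: "\<forall>l\<in>set ks. l \<le> R" "R = 0 \<or> (\<exists>l\<in>set ls. R \<le> l)"
  have Ra: "R \<le> a" using R a by fastforce
  have "a = m"
  proof (rule ccontr)
    assume "a \<noteq> m"
    then have up: "[Suc a..<Suc m] = Suc a # [Suc (Suc a)..<Suc m]" using a by (intro upt_conv_Cons) linarith
    have len_ws: "a < length ws" using a(2) up length_growth[of ws ?T] by simp
    \<comment> \<open>Here \<open>x\<close>, the letter after the first \<open>a\<close> letters of
      \<open>ws\<close>, is the one that grows row \<open>Suc a\<close> when \<open>N\<close> is
      absent.\<close>
    define vs where "vs = take a ws"
    define x where "x = ws ! a"
    define ws' where "ws' = drop (Suc a) ws"
    have ws: "ws = vs @ x # ws'" using len_ws by (simp add: vs_def x_def ws'_def id_take_nth_drop)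
    have "length vs = a" using len_ws by (simp add: vs_def)
    then have v: "growth vs ?T = [0..<a]" "snd (tableau_insert x (insert_word vs ?T)) = Suc a"
      using a(2) up unfolding ws by (auto simp: growth_append append_eq_append_conv)
    \<comment> \<open>Before \<open>x\<close> only rows of index below \<open>a\<close> have grown,
      so there are at most \<open>a\<close> rows, and an insertion grows a row whose index is at
      most the number of rows.\<close>
    have "\<forall>g\<in>set (growth (us @ vs) []). g < a"
      using v eq R Ra by (auto simp: growth_append set_canonical)
    then have "length (insert_word (us @ vs) []) \<le> a" by (intro length_insert_word_le) auto
    then show False using tableau_insert_snd_le[of x "insert_word vs ?T"] v
      by (simp add: insert_word_append)
  qed
  then show "growth (us @ ws) [] = canonical (ks @ m # ls)"
    using a eq by (simp add: growth_append)
qed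

lemma growth_insert_large:
  assumes "\<forall>y\<in>set us \<union> set ws. y < N"
    and "growth (us @ ws) [] = canonical (ks @ m # ls)"
    and "length us = sum_list ks" "\<forall>l\<in>set ls. l \<le> m"
  shows "growth (us @ N # ws) [] = canonical (ks @ Suc m # ls)"
proof -
  let ?T = "insert_word us []"
  have "set (concat ?T) = set us" using insert_word_set[of us "[]"] by simp
  then have "growth (us @ N # ws) [] = growth us [] @ 0 # bump_track 0 (growth ws ?T)"
    using growth_large_Cons[of ws ?T N] assms(1)
    by (simp add: growth_append Un_commute del: growth.simps(2) set_concat)
  moreover have "growth us [] = canonical ks" "growth ws ?T = [0..<m] @ canonical ls"
    using assms by (auto simp: growth_append append_eq_append_conv)
  ultimately show ?thesis using bump_track_canonical[of ls m] assms by simp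
qed

section \<open>Decreasing words and removal of the first letter\<close>

lemma tableau_insert_column:
  assumes "sorted_wrt (<) (x # ys)"
  shows "tableau_insert x (map (\<lambda>y. [y]) ys) = (map (\<lambda>y. [y]) (x # ys), length ys)"
  using assms by (induction ys arbitrary: x) auto

lemma insert_word_decreasing:
  assumes "sorted_wrt (<) (rev xs @ ys)"
  shows "insert_word xs (map (\<lambda>y. [y]) ys) = map (\<lambda>y. [y]) (rev xs @ ys)
    \<and> growth xs (map (\<lambda>y. [y]) ys) = [length ys..<length ys + length xs]"
  using assms
proof (induction xs arbitrary: ys)
  case (Cons x xs)
  have "sorted_wrt (<) (x # ys)" using Cons.prems by (simp add: sorted_wrt_append)
  from tableau_insert_column[OF this] show ?case using Cons.IH[of "x # ys"] Cons.prems
    by (auto simp: upt_conv_Cons)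
qed simp

text \<open>Bumping stops at the row that grows; if that is not the last row, the insertion never
  looks at \<open>r\<close>.\<close>

lemma tableau_insert_append_row:
  assumes "snd (tableau_insert x (T @ [r])) < length T"
  shows "tableau_insert x (T @ [r]) = (fst (tableau_insert x T) @ [r], snd (tableau_insert x T))"
  using assms
proof (induction T arbitrary: x)
  case (Cons r' rs)
  show ?case
  proof (cases "snd (row_insert x r')")
    case None
    then show ?thesis by (auto split: prod.splits)
  next
    case (Some y)
    then show ?thesis using Cons.IH[of y] Cons.prems by (auto split: prod.splits)
  qed
qed simp

lemma growth_append_row:
  assumes "\<forall>g\<in>set (growth xs (T @ [r])). g < length T"
  shows "growth xs (T @ [r]) = growth xs T"
  using assms
proof (induction xs arbitrary: T)
  case (Cons x xs)
  have eq: "tableau_insert x (T @ [r]) = (fst (tableau_insert x T) @ [r], snd (tableau_insert x T))"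
    using Cons.prems tableau_insert_append_row by simp
  have "\<forall>g\<in>set (growth xs (fst (tableau_insert x T) @ [r])). g < length (fst (tableau_insert x T))"
    using Cons.prems eq by (force simp: length_tableau_insert)
  from Cons.IH[OF this] eq show ?case by simp
qed simp

text \<open>The first letter of the word ends up alone in row \<open>m\<close> and plays no role in the rows above.\<close>

lemma growth_remove_first:
  assumes gr: "growth (N # bs @ ws) [] = canonical (Suc m # ls)"
    and "length bs = m" "sorted_wrt (<) (rev (N # bs))" "\<forall>l\<in>set ls. l \<le> m"
  shows "growth (bs @ ws) [] = canonical (m # ls)"
proof -
  let ?c = "map (\<lambda>y. [y]) (rev bs)"
  have 1: "insert_word (N # bs) [] = ?c @ [[N]]" "length (growth (N # bs) []) = Suc m"
    using insert_word_decreasing[of "N # bs" "[]"] assms by auto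
  have 2: "insert_word bs [] = ?c" "growth bs [] = [0..<m]"
    using insert_word_decreasing[of bs "[]"] assms by (auto simp: sorted_wrt_append)
  have "growth (N # bs @ ws) [] = growth (N # bs) [] @ growth ws (?c @ [[N]])"
    using growth_append[of "N # bs" ws "[]"] 1 by simp
  then have ws: "growth ws (?c @ [[N]]) = canonical ls"
    using gr 1(2) append_eq_append_conv[of "growth (N # bs) []" "[0..<Suc m]"]
    by (simp del: growth.simps)
  \<comment> \<open>All parts in \<open>ls\<close> are at most \<open>m\<close>, so every later
    growth index is below \<open>m\<close>, the index of the row \<open>[N]\<close>.\<close>
  have "\<forall>g\<in>set (growth ws (?c @ [[N]])). g < length ?c"
    unfolding ws using assms by (auto simp: set_canonical)
  then have "growth ws ?c = canonical ls" using growth_append_row ws by metis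
  then show ?thesis using 2 by (simp add: growth_append)
qed

section \<open>Invariance of growth under order-preserving relabelling\<close>

lemma row_insert_map:
  assumes "strict_mono_on (set (x # r)) f"
  shows "row_insert (f x) (map f r) = map_prod (map f) (map_option f) (row_insert x r)"
  using assms
proof (induction r)
  case (Cons y r)
  have "strict_mono_on (set (x # r)) f"
    using Cons.prems by (rule monotone_on_subset) auto
  then have "row_insert (f x) (map f r) = map_prod (map f) (map_option f) (row_insert x r)"
    by (rule Cons.IH)
  moreover have "f x < f y \<longleftrightarrow> x < y" using Cons.prems by (simp add: strict_mono_on_less)
  moreover obtain zs b where "row_insert x r = (zs, b)" by fastforce
  ultimately show ?case by simp
qed simp

lemma tableau_insert_map:
  assumes "strict_mono_on (insert x (set (concat T))) f"
  shows "tableau_insert (f x) (map (map f) T) = map_prod (map (map f)) id (tableau_insert x T)"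
  using assms
proof (induction T arbitrary: x)
  case (Cons r rs)
  obtain r' b where b: "row_insert x r = (r', b)" by fastforce
  have "strict_mono_on (set (x # r)) f"
    using Cons.prems by (rule monotone_on_subset) auto
  then have r: "row_insert (f x) (map f r) = (map f r', map_option f b)"
    using row_insert_map b by simp
  show ?case
  proof (cases b)
    case None
    then show ?thesis using b r by simp
  next
    case (Some y)
    have "strict_mono_on (insert y (set (concat rs))) f"
      using Cons.prems by (rule monotone_on_subset) (use row_insert_set[OF b] Some in auto)
    from Cons.IH[OF this] show ?thesis using b r Some by (auto split: prod.splits)
  qed
qed simp

lemma growth_map:
  assumes "strict_mono_on (set xs \<union> set (concat T)) f"
  shows "growth (map f xs) (map (map f) T) = growth xs T"
  using assms
proof (induction xs arbitrary: T)
  case (Cons x xs)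
  have 1: "strict_mono_on (insert x (set (concat T))) f"
    using Cons.prems by (rule monotone_on_subset) auto
  have "strict_mono_on (set xs \<union> set (concat (fst (tableau_insert x T)))) f"
    using Cons.prems by (rule monotone_on_subset) (use tableau_insert_set[of x T] in auto)
  from Cons.IH[OF this] tableau_insert_map[OF 1] show ?case by simp
qed simp

section \<open>Inversions and Coxeter length\<close>

text \<open>Pairs of positions, taken in all of \<open>nat\<close>, so that the set does not depend
  on the ambient symmetric group.\<close>

definition inversions :: "(nat \<Rightarrow> nat) \<Rightarrow> (nat \<times> nat) set"
  where "inversions w = {(i, j). i < j \<and> w j < w i}"

lemma inversions_id [simp]: "inversions id = {}" "inversions (\<lambda>a. a) = {}"
  by (auto simp: inversions_def)

lemma permutes_le: "w permutes {1..n} \<Longrightarrow> i \<le> n \<Longrightarrow> w i \<le> n"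
  by (metis atLeastAtMost_iff le0 permutes_in_image permutes_not_in)

lemma permutes_ge_1: "w permutes {1..n} \<Longrightarrow> 1 \<le> i \<Longrightarrow> 1 \<le> w i" for i :: nat
  by (metis atLeastAtMost_iff permutes_in_image permutes_not_in)

lemma permutes_gt: "w permutes {1..n} \<Longrightarrow> n < i \<Longrightarrow> w i = i" for i :: nat
  by (simp add: permutes_not_in)

lemma inversions_subset:
  assumes "w permutes {1..n}"
  shows "inversions w \<subseteq> {1..n} \<times> {1..n}"
proof
  fix x assume "x \<in> inversions w"
  then obtain i j where x: "x = (i, j)" "i < j" "w j < w i" by (auto simp: inversions_def)
  have "w 0 = 0" using assms by (simp add: permutes_not_in)
  then have "1 \<le> i" using x by (cases i) auto
  moreover have "j \<le> n"
  proof (rule ccontr)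
    assume "\<not> j \<le> n"
    then have "w j = j" using permutes_gt assms by simp
    moreover have "w i \<le> max i n" using permutes_gt[OF assms] permutes_le[OF assms]
      by (metis le_refl max.cobounded1 max.coboundedI2 not_le)
    ultimately show False using x \<open>\<not> j \<le> n\<close> by simp
  qed
  ultimately show "x \<in> {1..n} \<times> {1..n}" using x by auto
qed

lemma finite_inversions: "w permutes {1..n} \<Longrightarrow> finite (inversions w)"
  by (rule finite_subset[OF inversions_subset]) auto

lemma s_simps: "s i i = Suc i" "s i (Suc i) = i" "a \<noteq> i \<Longrightarrow> a \<noteq> Suc i \<Longrightarrow> s i a = a"
  by (auto simp: s_def transpose_def)

lemma s_s [simp]: "s i (s i a) = a"
  by (simp add: s_def)

lemma s_permutes: "i \<in> {1..<n} \<Longrightarrow> s i permutes {1..n}"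
  unfolding s_def by (rule permutes_swap_id) auto

lemma rmul_apply: "(x \<cdot> y) i = y (x i)"
  by (simp add: rmul_def)

lemma rmul_permutes: "\<lbrakk>x permutes A; y permutes A\<rbrakk> \<Longrightarrow> x \<cdot> y permutes A"
  unfolding rmul_def by (rule permutes_compose)

lemma s_rmul_permutes: "\<lbrakk>i \<in> {1..<n}; w permutes {1..n}\<rbrakk> \<Longrightarrow> s i \<cdot> w permutes {1..n}"
  by (rule rmul_permutes[OF s_permutes])

lemma s_less: "a < b \<Longrightarrow> (a, b) \<noteq> (i, Suc i) \<Longrightarrow> s i a < s i b"
  by (auto simp: s_def transpose_def)

text \<open>A left factor \<open>s i\<close> acts on positions and keeps the order of every pair
  except \<open>(i, Suc i)\<close>: old inversions are transported and this one pair is new.\<close>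

lemma inversions_s_rmul:
  assumes "w i < w (Suc i)"
  shows "inversions (s i \<cdot> w) = insert (i, Suc i) (map_prod (s i) (s i) ` inversions w)"
proof (intro equalityI subsetI)
  fix x assume "x \<in> inversions (s i \<cdot> w)"
  then obtain a b where x: "x = (a, b)" "a < b" "w (s i b) < w (s i a)"
    by (auto simp: inversions_def rmul_def)
  show "x \<in> insert (i, Suc i) (map_prod (s i) (s i) ` inversions w)"
  proof (cases "x = (i, Suc i)")
    case False
    then have "(s i a, s i b) \<in> inversions w" using x s_less by (auto simp: inversions_def)
    then show ?thesis using x by (intro insertI2 image_eqI[of _ _ "(s i a, s i b)"]) auto
  qed simp
next
  fix x assume "x \<in> insert (i, Suc i) (map_prod (s i) (s i) ` inversions w)"
  then consider "x = (i, Suc i)"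
    | a b where "x = (s i a, s i b)" "a < b" "w b < w a"
    by (auto simp: inversions_def)
  then show "x \<in> inversions (s i \<cdot> w)"
  proof cases
    case 2
    then have "(a, b) \<noteq> (i, Suc i)" using assms by auto
    then show ?thesis using 2 s_less by (auto simp: inversions_def rmul_def)
  qed (use assms in \<open>auto simp: inversions_def rmul_def s_simps\<close>)
qed

lemma card_inversions_s_rmul:
  assumes "w permutes {1..n}" "w i < w (Suc i)"
  shows "card (inversions (s i \<cdot> w)) = Suc (card (inversions w))"
proof -
  have "inj (map_prod (s i) (s i))" by (rule inj_on_inverseI[of _ "map_prod (s i) (s i)"]) auto
  then have "card (map_prod (s i) (s i) ` inversions w) = card (inversions w)"
    by (meson card_image inj_on_subset subset_UNIV)
  moreover have "(i, Suc i) \<notin> map_prod (s i) (s i) ` inversions w"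
  proof
    assume "(i, Suc i) \<in> map_prod (s i) (s i) ` inversions w"
    then obtain a b where "a < b" "s i a = i" "s i b = Suc i" by (auto simp: inversions_def)
    then have "a = Suc i" "b = i" by (metis s_s s_simps(1), metis s_s s_simps(2))
    then show False using \<open>a < b\<close> by simp
  qed
  ultimately show ?thesis using inversions_s_rmul assms finite_inversions[OF assms(1)] by simp
qed

lemma s_rmul_s_rmul [simp]: "s i \<cdot> (s i \<cdot> w) = w"
  by (auto simp: rmul_def)

lemma card_inversions_descent:
  assumes "w permutes {1..n}" "i \<in> {1..<n}" "w (Suc i) < w i"
  shows "card (inversions w) = Suc (card (inversions (s i \<cdot> w)))"
proof -
  have "(s i \<cdot> w) i < (s i \<cdot> w) (Suc i)" using assms by (simp add: rmul_def s_simps)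
  from card_inversions_s_rmul[OF s_rmul_permutes[OF assms(2,1)] this] show ?thesis by simp
qed

text \<open>Without a descent \<open>w\<close> increases on \<open>{1..n}\<close>, so
  \<open>i \<le> w i\<close> throughout, which forces the identity.\<close>

lemma permutes_descent:
  assumes "w permutes {1..n}" "w \<noteq> id"
  shows "\<exists>i\<in>{1..<n}. w (Suc i) < w i"
proof (rule ccontr)
  assume no: "\<not> ?thesis"
  have le: "w i < w (Suc i)" if "i \<in> {1..<n}" for i
  proof -
    have "w i \<noteq> w (Suc i)" using assms by (metis n_not_Suc_n permutes_inj injD)
    then show ?thesis using no that by (meson linorder_neqE_nat)
  qed
  have "i \<le> w i" if "1 \<le> i" "i \<le> n" for i
    using that
  proof (induction i rule: nat_induct_at_least)
    case base
    then show ?case using permutes_ge_1[OF assms(1), of 1] by simp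
  next
    case (Suc i)
    then show ?case using le[of i] by simp
  qed
  then have "w = id" using permutes_natset_ge[OF assms(1)] by simp
  then show False using assms by simp
qed

lemma word_prod_permutes: "set is \<subseteq> {1..<n} \<Longrightarrow> word_prod is permutes {1..n}"
  by (induction "is") (simp_all add: s_rmul_permutes permutes_id del: One_nat_def)

lemma card_inversions_word_prod:
  "set is \<subseteq> {1..<n} \<Longrightarrow> card (inversions (word_prod is)) \<le> length is"
proof (induction "is")
  case Nil
  then show ?case by simp
next
  case (Cons i "is")
  let ?w = "word_prod is"
  have w: "?w permutes {1..n}" using word_prod_permutes Cons.prems by simp
  consider "?w i < ?w (Suc i)" | "?w (Suc i) < ?w i"
    using permutes_inj[OF w] by (metis injD linorder_neqE_nat n_not_Suc_n)
  then show ?case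
    using card_inversions_s_rmul[OF w] card_inversions_descent[OF w, of i] Cons
    by cases auto
qed

lemma word_of_permutation:
  "w permutes {1..n} \<Longrightarrow>
    \<exists>is. length is = card (inversions w) \<and> set is \<subseteq> {1..<n} \<and> word_prod is = w"
proof (induction "card (inversions w)" arbitrary: w)
  case 0
  have "w = id"
  proof (rule ccontr)
    assume "w \<noteq> id"
    then obtain i where "i \<in> {1..<n}" "w (Suc i) < w i" using permutes_descent 0 by blast
    then show False using card_inversions_descent 0 by fastforce
  qed
  then show ?case using 0 by (intro exI[of _ "[]"]) auto
next
  case (Suc m)
  have "w \<noteq> id" using Suc.hyps(2) by auto
  then obtain i where i: "i \<in> {1..<n}" "w (Suc i) < w i" using permutes_descent Suc.prems by blast
  then have m: "card (inversions (s i \<cdot> w)) = m"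
    using card_inversions_descent Suc by fastforce
  then obtain "is" where "length is = m" "set is \<subseteq> {1..<n}" "word_prod is = s i \<cdot> w"
    using Suc.hyps(1) s_rmul_permutes[OF i(1) Suc.prems] by metis
  then show ?case using i Suc.hyps(2) by (intro exI[of _ "i # is"]) auto
qed

text \<open>One generator changes the number of inversions by one, so a word has at least that many
  letters; removing descents one by one gives a word attaining the bound.\<close>

lemma cox_length_eq: "w permutes {1..n} \<Longrightarrow> cox_length n w = card (inversions w)"
  unfolding cox_length_def
  by (rule Least_equality) (use word_of_permutation card_inversions_word_prod in blast)+

text \<open>Values \<open>a < b\<close> are inverted by the quotient exactly when \<open>x\<close>
  and \<open>y\<close> order the positions \<open>inv x a\<close> and \<open>inv x b\<close>
  differently. The maps \<open>?g\<close> and \<open>?f\<close> pass between value pairs and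
  position pairs, sorting each pair.\<close>

lemma card_inversions_quotient:
  assumes "x permutes {1..n}" "y permutes {1..n}"
  shows "card (inversions (Hilbert_Choice.inv x \<cdot> y)) =
    card ((inversions x - inversions y) \<union> (inversions y - inversions x))"
proof -
  let ?x' = "Hilbert_Choice.inv x"
  let ?g = "\<lambda>(a, b). if ?x' a < ?x' b then (?x' a, ?x' b) else (?x' b, ?x' a)"
  let ?f = "\<lambda>(i, j). if x i < x j then (x i, x j) else (x j, x i)"
  let ?A = "inversions (?x' \<cdot> y)"
  let ?B = "(inversions x - inversions y) \<union> (inversions y - inversions x)"
  have inv: "?x' (x i) = i" "x (?x' i) = i" for i
    using permutes_inverses[OF assms(1)] by auto
  have inj: "x i = x j \<longleftrightarrow> i = j" "y i = y j \<longleftrightarrow> i = j" "?x' i = ?x' j \<longleftrightarrow> i = j" for i j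
    using assms permutes_inv[OF assms(1)] by (metis permutes_inj injD)+
  have "bij_betw ?g ?A ?B"
  proof (rule bij_betw_byWitness[where f' = ?f])
    show "\<forall>a\<in>?A. ?f (?g a) = a" by (auto simp: inversions_def inv)
    show "\<forall>a\<in>?B. ?g (?f a) = a"
    proof
      fix z assume "z \<in> ?B"
      then obtain i j where "z = (i, j)" "i < j" by (auto simp: inversions_def)
      then show "?g (?f z) = z" by (simp add: inv)
    qed
    show "?g ` ?A \<subseteq> ?B"
    proof (rule image_subsetI)
      fix z assume "z \<in> ?A"
      then obtain a b where z: "z = (a, b)" "a < b" "y (?x' b) < y (?x' a)"
        by (auto simp: inversions_def rmul_def)
      moreover have "?x' a \<noteq> ?x' b" using z inj by simp
      ultimately show "?g z \<in> ?B" by (auto simp: inversions_def inv)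
    qed
    show "?f ` ?B \<subseteq> ?A"
    proof (rule image_subsetI)
      fix z assume "z \<in> ?B"
      then obtain i j where z: "z = (i, j)" "i < j" "(x j < x i) \<noteq> (y j < y i)"
        by (auto simp: inversions_def)
      moreover from z have "x i \<noteq> x j" "y i \<noteq> y j" using inj by auto
      ultimately show "?f z \<in> ?A" by (auto simp: inversions_def inv rmul_def)
    qed
  qed
  then show ?thesis by (rule bij_betw_same_card)
qed

text \<open>The length of the quotient is the size of the symmetric difference, so additivity of
  lengths says precisely that no inversion of \<open>x\<close> is missing from
  \<open>y\<close>.\<close>

lemma is_prefix_iff:
  assumes "x permutes {1..n}" "y permutes {1..n}"
  shows "is_prefix n x y \<longleftrightarrow> inversions x \<subseteq> inversions y"
proof -
  let ?A = "inversions x" and ?B = "inversions y"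
  have fin: "finite ?A" "finite ?B" using assms finite_inversions by auto
  have "Hilbert_Choice.inv x \<cdot> y permutes {1..n}"
    using assms by (intro rmul_permutes permutes_inv)
  then have "is_prefix n x y \<longleftrightarrow> card ?B = card ?A + card ((?A - ?B) \<union> (?B - ?A))"
    using assms card_inversions_quotient by (simp add: is_prefix_def cox_length_eq)
  also have "card ((?A - ?B) \<union> (?B - ?A)) = card (?A - ?B) + card (?B - ?A)"
    using fin by (intro card_Un_disjoint) auto
  also have "card ?B = card ?A + (card (?A - ?B) + card (?B - ?A)) \<longleftrightarrow> card (?A - ?B) = 0"
  proof -
    have "card ?A = card (?A \<inter> ?B) + card (?A - ?B)" "card ?B = card (?A \<inter> ?B) + card (?B - ?A)"
      using card_Int_Diff[OF fin(1), of ?B] card_Int_Diff[OF fin(2), of ?A]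
      by (simp_all add: Int_commute)
    then show ?thesis by linarith
  qed
  finally show ?thesis using fin by auto
qed

lemma inversions_inj:
  assumes "x permutes {1..n}" "y permutes {1..n}" "inversions x = inversions y"
  shows "x = y"
proof -
  have p: "Hilbert_Choice.inv x \<cdot> y permutes {1..n}"
    using assms by (intro rmul_permutes permutes_inv)
  have "card (inversions (Hilbert_Choice.inv x \<cdot> y)) = 0"
    using card_inversions_quotient assms by simp
  then have "y \<circ> Hilbert_Choice.inv x = id"
    using word_of_permutation[OF p] by (auto simp: rmul_def)
  then have "y = id \<circ> x" using permutes_inverses[OF assms(1)] by (metis comp_apply ext id_comp)
  then show ?thesis by simp
qed

section \<open>Parabolic subgroups\<close>

text \<open>Block indices are 0-based. Position 0 gets index 0, and positions beyond the sum get the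
  extra index \<open>length lam\<close>.\<close>

fun block_of :: "nat list \<Rightarrow> nat \<Rightarrow> nat"
  where
    "block_of [] i = 0"
  | "block_of (l # ls) i = (if i \<le> l then 0 else Suc (block_of ls (i - l)))"

text \<open>An explicit candidate for \<open>w_J lam\<close>. The case \<open>i = 0\<close> keeps 0
  fixed, as a permutation of \<open>{1..sum_list lam}\<close> must.\<close>

fun rev_blocks :: "nat list \<Rightarrow> nat \<Rightarrow> nat"
  where
    "rev_blocks [] i = i"
  | "rev_blocks (l # ls) i =
      (if i = 0 then 0 else if i \<le> l then Suc l - i else l + rev_blocks ls (i - l))"

text \<open>The row-form of \<open>w_J lam \<cdot> e\<close>, written block by block;
  \<open>off\<close> counts the positions already read.\<close>

fun dec_word :: "nat list \<Rightarrow> nat \<Rightarrow> (nat \<Rightarrow> nat) \<Rightarrow> nat list"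
  where
    "dec_word [] off e = []"
  | "dec_word (l # ls) off e = rev (map e [Suc off..<Suc (off + l)]) @ dec_word ls (off + l) e"

lemma block_of_mono: "i \<le> j \<Longrightarrow> block_of lam i \<le> block_of lam j"
  by (induction lam arbitrary: i j) auto

lemma block_of_less_iff:
  "1 \<le> i \<Longrightarrow> t \<le> length lam \<Longrightarrow> block_of lam i < t \<longleftrightarrow> i \<le> sum_list (take t lam)"
proof (induction lam arbitrary: i t)
  case (Cons l ls)
  then show ?case by (cases t) (auto simp: less_eq_Suc_le)
qed auto

lemma block_of_append:
  "i \<le> sum_list (ks @ ls) \<Longrightarrow> 1 \<le> i \<Longrightarrow>
    block_of (ks @ ls) i = (if i \<le> sum_list ks then block_of ks i
      else length ks + block_of ls (i - sum_list ks))"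
  by (induction ks arbitrary: i) auto

lemma block_of_Suc_eq_iff:
  assumes "1 \<le> i" "i < sum_list lam"
  shows "block_of lam i = block_of lam (Suc i) \<longleftrightarrow>
    (\<nexists>t. 1 \<le> t \<and> t < length lam \<and> sum_list (take t lam) = i)"
proof
  assume eq: "block_of lam i = block_of lam (Suc i)"
  show "\<nexists>t. 1 \<le> t \<and> t < length lam \<and> sum_list (take t lam) = i"
  proof clarify
    fix t assume t: "1 \<le> t" "t < length lam" "i = sum_list (take t lam)"
    have "block_of lam i < t \<longleftrightarrow> i \<le> sum_list (take t lam)"
      by (rule block_of_less_iff) (use assms t in auto)
    moreover have "block_of lam (Suc i) < t \<longleftrightarrow> Suc i \<le> sum_list (take t lam)"
      by (rule block_of_less_iff) (use assms t in auto)
    ultimately show False using eq t by auto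
  qed
next
  assume no: "\<nexists>t. 1 \<le> t \<and> t < length lam \<and> sum_list (take t lam) = i"
  show "block_of lam i = block_of lam (Suc i)"
  proof (rule ccontr)
    define t where "t = block_of lam (Suc i)"
    assume "block_of lam i \<noteq> block_of lam (Suc i)"
    then have "block_of lam i < t" using block_of_mono[of i "Suc i" lam] by (simp add: t_def)
    moreover have t: "t < length lam"
      using block_of_less_iff[of "Suc i" "length lam" lam] assms by (simp add: t_def)
    ultimately have "i \<le> sum_list (take t lam)" using block_of_less_iff[of i t lam] assms by simp
    moreover have "\<not> Suc i \<le> sum_list (take t lam)"
      using block_of_less_iff[of "Suc i" t lam] t by (simp add: t_def)
    ultimately have "sum_list (take t lam) = i" by simp
    then show False using no t \<open>block_of lam i < t\<close> by auto
  qed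
qed

lemma s_inject: "s i = s j \<longleftrightarrow> i = j"
proof
  assume "s i = s j"
  then have "s j i = Suc i" by (metis s_simps(1))
  then show "i = j" by (cases "i = j"; cases "i = Suc j") (simp_all add: s_simps)
qed simp

lemma J_eq:
  "J lam = s ` {i. 1 \<le> i \<and> i < sum_list lam \<and> block_of lam i = block_of lam (Suc i)}"
proof -
  have "J lam = s ` ({1..<sum_list lam} - {sum_list (take i lam) | i. 1 \<le> i \<and> i < length lam})"
    unfolding J_def by (auto simp: s_inject)
  also have "{1..<sum_list lam} - {sum_list (take i lam) | i. 1 \<le> i \<and> i < length lam} =
      {i. 1 \<le> i \<and> i < sum_list lam \<and> block_of lam i = block_of lam (Suc i)}"
    using block_of_Suc_eq_iff[of _ lam] by force
  finally show ?thesis .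
qed

lemma rev_blocks_eq_0 [simp]: "rev_blocks lam i = 0 \<longleftrightarrow> i = 0"
proof (induction lam arbitrary: i)
  case (Cons l ls)
  show ?case using Cons.IH[of "i - l"] by (cases "i \<le> l") (auto simp: gr0_conv_Suc)
qed simp

lemma rev_blocks_pos [simp]: "0 < rev_blocks lam i \<longleftrightarrow> 0 < i"
  using rev_blocks_eq_0 neq0_conv by metis

lemma rev_blocks_rev_blocks [simp]: "rev_blocks lam (rev_blocks lam i) = i"
proof (induction lam arbitrary: i)
  case (Cons l ls)
  then show ?case using Cons.IH[of "i - l"] by (cases "i \<le> l") auto
qed simp

lemma rev_blocks_le: "i \<le> sum_list lam \<Longrightarrow> rev_blocks lam i \<le> sum_list lam"
proof (induction lam arbitrary: i)
  case (Cons l ls)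
  then show ?case using Cons.IH[of "i - l"] by (cases "i \<le> l") auto
qed simp

lemma rev_blocks_gt: "sum_list lam < i \<Longrightarrow> rev_blocks lam i = i"
proof (induction lam arbitrary: i)
  case (Cons l ls)
  then show ?case using Cons.IH[of "i - l"] by (cases "i \<le> l") auto
qed simp

lemma block_of_rev_blocks: "1 \<le> i \<Longrightarrow> block_of lam (rev_blocks lam i) = block_of lam i"
proof (induction lam arbitrary: i)
  case (Cons l ls)
  then show ?case using Cons.IH[of "i - l"] Cons.prems by (cases "i \<le> l") auto
qed simp

lemma rev_blocks_less:
  "\<lbrakk>1 \<le> i; i < j; j \<le> sum_list lam; block_of lam i = block_of lam j\<rbrakk> \<Longrightarrow>
    rev_blocks lam j < rev_blocks lam i"
proof (induction lam arbitrary: i j)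
  case (Cons l ls)
  show ?case
  proof (cases "j \<le> l")
    case True
    then show ?thesis using Cons.prems by auto
  next
    case False
    then have "l < i" using Cons.prems by (auto split: if_splits)
    then show ?thesis using Cons.prems False Cons.IH[of "i - l" "j - l"] by auto
  qed
qed simp

lemma rev_blocks_permutes: "rev_blocks lam permutes {1..sum_list lam}"
proof (rule bij_imp_permutes)
  have "rev_blocks lam i \<in> {1..sum_list lam}" if "i \<in> {1..sum_list lam}" for i
    using that rev_blocks_le[of i lam] by (simp add: Suc_le_eq)
  then show "bij_betw (rev_blocks lam) {1..sum_list lam} {1..sum_list lam}"
    by (intro bij_betw_byWitness[where f' = "rev_blocks lam"]) auto
  show "rev_blocks lam i = i" if "i \<notin> {1..sum_list lam}" for i
  proof (cases "i = 0")
    case False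
    then show ?thesis using that rev_blocks_gt by simp
  qed simp
qed

section \<open>The parabolic subgroup as the block-preserving permutations\<close>

lemma group_Sym: "group (Sym n)"
proof (rule groupI)
  fix x assume x: "x \<in> carrier (Sym n)"
  show "\<exists>y\<in>carrier (Sym n). y \<otimes>\<^bsub>Sym n\<^esub> x = \<one>\<^bsub>Sym n\<^esub>"
  proof
    show "Hilbert_Choice.inv x \<in> carrier (Sym n)" using x by (simp add: Sym_def permutes_inv)
    show "Hilbert_Choice.inv x \<otimes>\<^bsub>Sym n\<^esub> x = \<one>\<^bsub>Sym n\<^esub>"
      using x by (simp add: Sym_def rmul_def permutes_inv_o)
  qed
qed (auto simp: Sym_def rmul_def permutes_compose permutes_id)

definition block_perms :: "nat list \<Rightarrow> (nat \<Rightarrow> nat) set"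
  where "block_perms lam =
    {w. w permutes {1..sum_list lam} \<and> (\<forall>i. block_of lam (w i) = block_of lam i)}"

lemma block_perms_rmul:
  "\<lbrakk>x \<in> block_perms lam; y \<in> block_perms lam\<rbrakk> \<Longrightarrow> x \<cdot> y \<in> block_perms lam"
  unfolding block_perms_def by (auto intro: rmul_permutes simp: rmul_apply simp del: One_nat_def)

text \<open>Generators preserve blocks. Conversely, a descent of a block-preserving permutation lies
  inside one block, so it can be removed by a generator in \<open>J lam\<close>; induction on the
  number of inversions finishes.\<close>

lemma W_J_eq: "W_J lam = block_perms lam"
proof (intro equalityI subsetI)
  let ?n = "sum_list lam"
  interpret group "Sym ?n" by (rule group_Sym)
  have gen: "h \<in> block_perms lam" "Group.m_inv (Sym ?n) h = h" if h: "h \<in> J lam" for h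
  proof -
    obtain i where i: "h = s i" "1 \<le> i" "i < ?n" "block_of lam i = block_of lam (Suc i)"
      using h by (auto simp: J_eq)
    have p: "h permutes {1..?n}" using s_permutes[of i ?n] i by simp
    have "block_of lam (h j) = block_of lam j" for j
      using i s_simps by (cases "j = i"; cases "j = Suc i") auto
    then show "h \<in> block_perms lam" using p by (simp add: block_perms_def)
    have "h \<otimes>\<^bsub>Sym ?n\<^esub> h = \<one>\<^bsub>Sym ?n\<^esub>" using i by (auto simp: Sym_def rmul_def)
    then show "Group.m_inv (Sym ?n) h = h" using p by (intro inv_equality) (auto simp: Sym_def)
  qed
  fix w
  {
    assume "w \<in> W_J lam"
    then have "w \<in> generate (Sym ?n) (J lam)" by (simp add: W_J_def)
    then show "w \<in> block_perms lam"
    proof (induction rule: generate.induct)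
      case one
      have "id \<in> block_perms lam" unfolding block_perms_def using permutes_id by auto
      then show ?case by (simp add: Sym_def id_def)
    next
      case (eng h1 h2)
      then show ?case using block_perms_rmul by (simp add: Sym_def)
    qed (use gen in auto)
  }
  assume "w \<in> block_perms lam"
  then show "w \<in> W_J lam"
  proof (induction "card (inversions w)" arbitrary: w)
    case 0
    then have p: "w permutes {1..?n}" by (simp add: block_perms_def)
    then have "w = \<one>\<^bsub>Sym ?n\<^esub>" using word_of_permutation[OF p] 0 by (auto simp: Sym_def)
    then show ?case unfolding W_J_def by (metis generate.one)
  next
    case (Suc m)
    then have p: "w permutes {1..?n}" and b: "\<forall>i. block_of lam (w i) = block_of lam i"
      by (auto simp: block_perms_def)
    have "w \<noteq> id" using Suc.hyps(2) by auto
    then obtain i where i: "i \<in> {1..<?n}" "w (Suc i) < w i" using permutes_descent p by blast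
    \<comment> \<open>Block indices are monotone: \<open>w (Suc i) < w i\<close> gives one
      inequality and \<open>i < Suc i\<close> the other.\<close>
    have "block_of lam i = block_of lam (Suc i)"
      using b block_of_mono[of "w (Suc i)" "w i" lam] block_of_mono[of i "Suc i" lam] i by auto
    then have J: "s i \<in> J lam" using i by (auto simp: J_eq)
    have "card (inversions (s i \<cdot> w)) = m"
      using card_inversions_descent[OF p i] Suc.hyps(2) by simp
    moreover have "s i \<cdot> w \<in> block_perms lam"
      using gen(1)[OF J] Suc.prems by (rule block_perms_rmul)
    ultimately have "s i \<cdot> w \<in> generate (Sym ?n) (J lam)" using Suc.hyps(1) W_J_def by blast
    then have "s i \<otimes>\<^bsub>Sym ?n\<^esub> (s i \<cdot> w) \<in> W_J lam"
      unfolding W_J_def by (rule generate.eng[OF generate.incl[OF J]])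
    then show ?case by (simp add: Sym_def)
  qed
qed

text \<open>Positions in different blocks keep their order, so only pairs within a block can be
  inverted, and the block reversal inverts all of those.\<close>

lemma inversions_block_perm:
  assumes "w \<in> block_perms lam"
  shows "inversions w \<subseteq> inversions (rev_blocks lam)"
proof
  fix x assume x: "x \<in> inversions w"
  then obtain i j where ij: "x = (i, j)" "i < j" "w j < w i" by (auto simp: inversions_def)
  have b: "block_of lam (w i) = block_of lam i" for i using assms by (simp add: block_perms_def)
  have r: "1 \<le> i" "j \<le> sum_list lam"
    using inversions_subset[of w "sum_list lam"] x ij assms by (auto simp: block_perms_def)
  have "block_of lam i = block_of lam j"
    using b[of i] b[of j] block_of_mono[of "w j" "w i" lam] block_of_mono[of i j lam] ij by auto
  then show "x \<in> inversions (rev_blocks lam)"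
    using ij r rev_blocks_less by (simp add: inversions_def)
qed

text \<open>By containment of inversion sets the reversal has maximal length; an element of equal
  length has the same inversions and is therefore the same permutation.\<close>

lemma w_J_eq: "w_J lam = rev_blocks lam"
  unfolding w_J_def W_J_eq
proof (rule the_equality)
  let ?n = "sum_list lam"
  have rb: "rev_blocks lam \<in> block_perms lam"
    using rev_blocks_permutes[of lam] block_of_rev_blocks[of _ lam]
    by (auto simp: block_perms_def) (metis block_of_rev_blocks less_one linorder_not_less rev_blocks_eq_0)
  have fin: "finite (inversions (rev_blocks lam))"
    using finite_inversions rev_blocks_permutes by blast
  have len: "cox_length ?n v = card (inversions v)" if "v \<in> block_perms lam" for v
    using that cox_length_eq by (simp add: block_perms_def)
  show "rev_blocks lam \<in> block_perms lam \<and>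
    (\<forall>v\<in>block_perms lam. cox_length ?n v \<le> cox_length ?n (rev_blocks lam))"
    using rb len fin inversions_block_perm by (auto intro!: card_mono)
  fix w assume w: "w \<in> block_perms lam \<and>
    (\<forall>v\<in>block_perms lam. cox_length ?n v \<le> cox_length ?n w)"
  then have "card (inversions (rev_blocks lam)) \<le> card (inversions w)" using len rb by metis
  then have "inversions w = inversions (rev_blocks lam)"
    using inversions_block_perm w fin by (intro card_subset_eq) (auto simp: card_mono le_antisym)
  then show "w = rev_blocks lam"
    using inversions_inj[of w ?n "rev_blocks lam"] w rev_blocks_permutes
    by (auto simp: block_perms_def)
qed

text \<open>A descent inside a block would be removed by a generator of \<open>W_J lam\<close>,
  shortening \<open>e\<close>; adjacent comparisons then chain along the block. Conversely, if
  \<open>e\<close> increases on blocks, its inversions join different blocks, whose order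
  \<open>inv h\<close> keeps, so they map injectively to inversions of
  \<open>h \<cdot> e\<close>.\<close>

lemma X_J_iff:
  "e \<in> X_J lam \<longleftrightarrow> e permutes {1..sum_list lam} \<and>
    (\<forall>i j. 1 \<le> i \<longrightarrow> i < j \<longrightarrow> j \<le> sum_list lam \<longrightarrow> block_of lam i = block_of lam j \<longrightarrow> e i < e j)"
    (is "?L \<longleftrightarrow> ?p \<and> ?R")
proof -
  let ?n = "sum_list lam"
  have L: "?L \<longleftrightarrow> ?p \<and> (\<forall>h\<in>block_perms lam. cox_length ?n e \<le> cox_length ?n (h \<cdot> e))"
    by (auto simp: X_J_def r_coset_def W_J_eq Sym_def)
  have "?R" if "?p" "?L"
  proof (intro allI impI)
    fix i j assume ij: "1 \<le> i" "i < j" "j \<le> ?n" "block_of lam i = block_of lam j"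
    from ij(2,1,3,4) show "e i < e j"
    proof (induction j rule: less_Suc_induct)
      case (1 i)
      have "s i \<in> W_J lam"
        unfolding W_J_def by (intro generate.incl) (use 1 in \<open>auto simp: J_eq\<close>)
      then have le: "cox_length ?n e \<le> cox_length ?n (s i \<cdot> e)" using L that W_J_eq by blast
      have i: "i \<in> {1..<?n}" using 1 by auto
      have "card (inversions e) \<le> card (inversions (s i \<cdot> e))"
        using le that(1) s_rmul_permutes[OF i that(1)] by (simp add: cox_length_eq)
      then have "\<not> e (Suc i) < e i" using card_inversions_descent[OF that(1) i] by linarith
      moreover have "e i \<noteq> e (Suc i)" using permutes_inj[OF that(1)] by (metis injD n_not_Suc_n)
      ultimately show ?case by linarith
    next
      case (2 i j k)
      then have "block_of lam i = block_of lam j" "block_of lam j = block_of lam k"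
        using block_of_mono[of i j lam] block_of_mono[of j k lam] by auto
      then show ?case using 2 by (meson le_trans less_imp_le less_trans)
    qed
  qed
  moreover have "?L" if "?p" "?R"
    unfolding L
  proof (intro conjI ballI)
    fix h assume h: "h \<in> block_perms lam"
    then have hp: "h permutes {1..?n}" and b: "\<And>i. block_of lam (h i) = block_of lam i"
      by (auto simp: block_perms_def)
    have he: "h \<cdot> e permutes {1..?n}" using hp that(1) by (rule rmul_permutes)
    let ?h' = "Hilbert_Choice.inv h"
    have inv: "h (?h' i) = i" for i using permutes_inverses[OF hp] by simp
    have b': "block_of lam (?h' i) = block_of lam i" for i using b[of "?h' i"] inv by simp
    have "map_prod ?h' ?h' ` inversions e \<subseteq> inversions (h \<cdot> e)"
    proof (rule image_subsetI)
      fix z assume "z \<in> inversions e"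
      then obtain i j where z: "z = (i, j)" "(i, j) \<in> inversions e" by (cases z) auto
      then have r: "1 \<le> i" "j \<le> ?n" "i < j" "e j < e i"
        using inversions_subset[OF that(1)] by (auto simp: inversions_def)
      then have "block_of lam i \<noteq> block_of lam j" using that(2) by (metis less_asym)
      then have "block_of lam i < block_of lam j" using block_of_mono[of i j lam] r by simp
      then have "?h' i < ?h' j"
        using block_of_mono[of "?h' j" "?h' i" lam] b'[of i] b'[of j] by (metis not_le)
      then show "map_prod ?h' ?h' z \<in> inversions (h \<cdot> e)"
        using z r inv by (simp add: inversions_def rmul_def)
    qed
    then have "card (map_prod ?h' ?h' ` inversions e) \<le> card (inversions (h \<cdot> e))"
      using finite_inversions[OF he] by (intro card_mono)
    moreover have "inj_on (map_prod ?h' ?h') (inversions e)"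
      by (rule inj_on_inverseI[of _ "map_prod h h"]) (auto simp: inv)
    ultimately show "cox_length ?n e \<le> cox_length ?n (h \<cdot> e)"
      using that(1) he by (simp add: cox_length_eq card_image)
  qed (use that in auto)
  moreover have "?p" if "?L" using that L by simp
  ultimately show ?thesis by blast
qed

section \<open>Row-forms as words decreasing on blocks\<close>

lemma dec_word_append:
  "dec_word (ks @ ls) off e = dec_word ks off e @ dec_word ls (off + sum_list ks) e"
  by (induction ks arbitrary: off) (auto simp: add.assoc)

lemma length_dec_word [simp]: "length (dec_word lam off e) = sum_list lam"
  by (induction lam arbitrary: off) auto

lemma set_dec_word: "set (dec_word lam off e) = e ` {off<..off + sum_list lam}"
proof (induction lam arbitrary: off)
  case (Cons l ls)
  have "{off<..off + sum_list (l # ls)} = {Suc off..<Suc (off + l)} \<union> {off + l<..off + l + sum_list ls}"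
    by auto
  then show ?case using Cons by (simp add: image_Un)
qed simp

text \<open>The shifts \<open>a\<close> and \<open>b\<close> let the words start at different
  positions, as happens after a position has been inserted.\<close>

lemma dec_word_cong:
  "(\<And>i. off < i \<Longrightarrow> i \<le> off + sum_list lam \<Longrightarrow> e (i + a) = e' (i + b)) \<Longrightarrow>
    dec_word lam (off + a) e = dec_word lam (off + b) e'"
proof (induction lam arbitrary: off)
  case (Cons l ls)
  have "map e [Suc (off + a)..<Suc (off + a + l)] = map e' [Suc (off + b)..<Suc (off + b + l)]"
  proof (rule nth_equalityI)
    fix i assume "i < length (map e [Suc (off + a)..<Suc (off + a + l)])"
    then show "map e [Suc (off + a)..<Suc (off + a + l)] ! i = map e' [Suc (off + b)..<Suc (off + b + l)] ! i"
      using Cons.prems[of "Suc off + i"] by (simp add: ac_simps)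
  qed simp
  moreover have "dec_word ls (off + l + a) e = dec_word ls (off + l + b) e'"
    by (rule Cons.IH) (use Cons.prems in auto)
  ultimately show ?case by (simp add: ac_simps)
qed simp

lemma dec_word_map: "dec_word lam off (f \<circ> e) = map f (dec_word lam off e)"
  by (induction lam arbitrary: off) (auto simp: rev_map)

lemma dec_word_eq_rev_blocks:
  "map (\<lambda>i. e (off + rev_blocks lam i)) [Suc 0..<Suc (sum_list lam)] = dec_word lam off e"
proof (induction lam arbitrary: off)
  case (Cons l ls)
  let ?g = "\<lambda>i. e (off + rev_blocks (l # ls) i)"
  have "[Suc 0..<Suc (sum_list (l # ls))] = [Suc 0..<Suc l] @ [Suc l..<Suc l + sum_list ls]"
    using upt_add_eq_append[of "Suc 0" "Suc l" "sum_list ls"] by simp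
  also have "[Suc l..<Suc l + sum_list ls] = map (\<lambda>i. i + l) [Suc 0..<Suc (sum_list ls)]"
    by (intro nth_equalityI) auto
  finally have "map ?g [Suc 0..<Suc (sum_list (l # ls))] = map ?g [Suc 0..<Suc l] @
      map (\<lambda>i. ?g (i + l)) [Suc 0..<Suc (sum_list ls)]"
    by (simp add: comp_def)
  moreover have "map ?g [Suc 0..<Suc l] = rev (map e [Suc off..<Suc (off + l)])"
    by (rule nth_equalityI) (auto simp: rev_nth Suc_diff_Suc)
  moreover have "map (\<lambda>i. ?g (i + l)) [Suc 0..<Suc (sum_list ls)]
      = map (\<lambda>i. e ((off + l) + rev_blocks ls i)) [Suc 0..<Suc (sum_list ls)]"
    by (rule map_cong) (auto simp: add.assoc)
  ultimately show ?case using Cons by simp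
qed simp

lemma row_form_w_J: "row_form (sum_list lam) (w_J lam \<cdot> e) = dec_word lam 0 e"
  using dec_word_eq_rev_blocks[of e 0 lam] by (simp add: row_form_def w_J_eq rmul_def comp_def)

text \<open>By induction on \<open>l\<close>: the new front letter is the largest, so it contributes
  a \<open>0\<close> and is pushed down one row at each later step.\<close>

lemma growth_decreasing_large:
  "\<forall>y\<in>set (concat T). y \<le> off \<Longrightarrow> growth (rev [Suc off..<Suc (off + l)]) T = [0..<l]"
proof (induction l)
  case (Suc l)
  have "rev [Suc off..<Suc (off + Suc l)] = Suc (off + l) # rev [Suc off..<Suc (off + l)]"
    by (simp add: upt_Suc_append)
  moreover have "growth (Suc (off + l) # rev [Suc off..<Suc (off + l)]) T = 0 # bump_track 0 [0..<l]"
    using Suc growth_large_Cons[of "rev [Suc off..<Suc (off + l)]" T "Suc (off + l)"] by fastforce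
  ultimately show ?case using bump_track_canonical[of "[]" l] by simp
qed simp

lemma growth_dec_word_id:
  "\<forall>y\<in>set (concat T). y \<le> off \<Longrightarrow> growth (dec_word lam off id) T = canonical lam"
proof (induction lam arbitrary: off T)
  case (Cons l ls)
  let ?bs = "rev [Suc off..<Suc (off + l)]"
  have "\<forall>y\<in>set (concat (insert_word ?bs T)). y \<le> off + l"
    unfolding insert_word_set using Cons.prems by (auto intro: trans_le_add1)
  then show ?case
    using Cons.IH growth_decreasing_large[OF Cons.prems, of l] by (simp add: growth_append)
qed simp

text \<open>The element \<open>w_J lam\<close> has canonical growth, being the case
  \<open>e = id\<close>; so cell membership becomes an equation between lists.\<close>

lemma Z_iff:
  "e \<in> Z lam \<longleftrightarrow> e \<in> X_J lam \<and> growth (dec_word lam 0 e) [] = canonical lam"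
proof -
  have "row_form (sum_list lam) (w_J lam) = dec_word lam 0 id"
    using row_form_w_J[of lam id] by (simp add: rmul_def)
  then show ?thesis
    using growth_dec_word_id[of "[]" 0 lam]
    by (auto simp: Z_def right_cell_equiv_iff row_form_w_J)
qed

section \<open>Diagrams as column assignments\<close>

text \<open>Here \<open>b j\<close> is the row and \<open>c j\<close> the column of the node
  numbered \<open>j\<close> column by column: no column is empty, and the numbers follow column
  order.\<close>

definition valid_cols :: "(nat \<Rightarrow> nat) \<Rightarrow> nat \<Rightarrow> (nat \<Rightarrow> nat) \<Rightarrow> nat \<Rightarrow> bool"
  where "valid_cols b n c C \<longleftrightarrow> c ` {1..n} = {1..C} \<and>
    (\<forall>j j'. 1 \<le> j \<longrightarrow> j < j' \<longrightarrow> j' \<le> n \<longrightarrow> c j < c j' \<or> c j = c j' \<and> b j < b j')"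

text \<open>The greedy assignment opens a new column only when the row fails to go up; the test
  \<open>j \<noteq> 0\<close> gives the first value column 1.\<close>

fun min_cols :: "(nat \<Rightarrow> nat) \<Rightarrow> nat \<Rightarrow> nat"
  where
    "min_cols b 0 = 0"
  | "min_cols b (Suc j) = (if j \<noteq> 0 \<and> b j < b (Suc j) then min_cols b j else Suc (min_cols b j))"

lemma min_cols_pos: "1 \<le> j \<Longrightarrow> 1 \<le> min_cols b j"
  by (induction j) auto

lemma valid_cols_min_cols: "valid_cols b n (min_cols b) (min_cols b n)"
proof -
  have "min_cols b ` {1..n} = {1..min_cols b n}"
  proof (induction n)
    case (Suc n)
    have "{1..Suc n} = insert (Suc n) {1..n}" by auto
    moreover have "{1..Suc (min_cols b n)} = insert (Suc (min_cols b n)) {1..min_cols b n}" by auto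
    moreover have "min_cols b n \<in> {1..min_cols b n}" if "n \<noteq> 0" using min_cols_pos[of n b] that by auto
    ultimately show ?case using Suc by (simp add: insert_absorb)
  qed simp
  moreover have "1 \<le> j \<longrightarrow>
      min_cols b j < min_cols b j' \<or> min_cols b j = min_cols b j' \<and> b j < b j'" if "j < j'" for j j'
    using that by (induction rule: less_Suc_induct) auto
  ultimately show ?thesis by (auto simp: valid_cols_def)
qed

lemma valid_cols_mono:
  assumes "valid_cols b n c C" "1 \<le> j" "j \<le> j'" "j' \<le> n"
  shows "c j \<le> c j'"
proof (cases "j = j'")
  case False
  then show ?thesis using assms unfolding valid_cols_def by (metis le_less order_le_imp_less_or_eq)
qed simp

text \<open>Wherever the greedy assignment opens a column, every valid one must; the comparison of
  increments is written additively to avoid subtraction on \<open>nat\<close>.\<close>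

lemma valid_cols_step:
  assumes "valid_cols b n c C" "1 \<le> j" "j \<le> j'" "j' \<le> n"
  shows "c j + min_cols b j' \<le> c j' + min_cols b j"
  using assms(3,4)
proof (induction rule: dec_induct)
  case (step m)
  have "c m < c (Suc m) \<or> c m = c (Suc m) \<and> b m < b (Suc m)"
    using assms step by (auto simp: valid_cols_def)
  then show ?case using step assms by auto
qed simp

lemma valid_cols_last:
  assumes "valid_cols b n c C" "1 \<le> n"
  shows "c n = C"
proof -
  have im: "c ` {1..n} = {1..C}" using assms by (simp add: valid_cols_def)
  have "c n \<in> c ` {1..n}" using assms by simp
  then have "c n \<in> {1..C}" unfolding im .
  moreover from this have "C \<in> c ` {1..n}" unfolding im by simp
  then obtain j where "j \<in> {1..n}" "C = c j" by blast
  then have "C \<le> c n" using valid_cols_mono[OF assms(1)] by simp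
  ultimately show ?thesis by simp
qed

text \<open>Comparing increments from 1 to \<open>j\<close> bounds \<open>c j\<close> below; if the
  totals agree, comparing them from \<open>j\<close> to \<open>n\<close> bounds it above.\<close>

lemma min_cols_le:
  assumes "valid_cols b n c C" "1 \<le> n"
  shows "min_cols b n \<le> C" and "C \<le> min_cols b n \<Longrightarrow> j \<in> {1..n} \<Longrightarrow> c j = min_cols b j"
proof -
  have pos: "1 \<le> c j" if "j \<in> {1..n}" for j
  proof -
    have "c j \<in> {1..C}" using assms(1) that by (auto simp: valid_cols_def)
    then show ?thesis by simp
  qed
  have le: "min_cols b j \<le> c j" if "j \<in> {1..n}" for j
    using valid_cols_step[OF assms(1), of 1 j] pos[of 1] that by simp
  show "min_cols b n \<le> C" using le[of n] valid_cols_last[OF assms] assms(2) by simp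
  assume "C \<le> min_cols b n" "j \<in> {1..n}"
  then show "c j = min_cols b j"
    using valid_cols_step[OF assms(1), of j n] le[of j] valid_cols_last[OF assms] by simp
qed

text \<open>A node is recorded by its column-by-column number \<open>j\<close>; its row is then the block containing
  the position of the value \<open>j\<close>.\<close>

definition row_of :: "nat list \<Rightarrow> (nat \<Rightarrow> nat) \<Rightarrow> nat \<Rightarrow> nat"
  where "row_of lam d j = block_of lam (Hilbert_Choice.inv d j)"

definition diagram_of :: "nat list \<Rightarrow> (nat \<Rightarrow> nat) \<Rightarrow> (nat \<Rightarrow> nat) \<Rightarrow> diagram"
  where "diagram_of lam d c = (\<lambda>j. (Suc (row_of lam d j), c j)) ` {1..sum_list lam}"

section \<open>From column assignments to diagrams\<close>

lemma block_eq_interval: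
  assumes "t < length lam"
  shows "{i \<in> {1..sum_list lam}. block_of lam i = t} =
    {sum_list (take t lam)<..sum_list (take (Suc t) lam)}" (is "?L = ?R")
proof -
  have "sum_list (take (Suc t) lam) \<le> sum_list lam"
    by (metis append_take_drop_id le_add1 sum_list_append)
  moreover have "block_of lam i = t \<longleftrightarrow> block_of lam i < Suc t \<and> \<not> block_of lam i < t" for i by auto
  moreover have "block_of lam i < Suc t \<longleftrightarrow> i \<le> sum_list (take (Suc t) lam)"
      "block_of lam i < t \<longleftrightarrow> i \<le> sum_list (take t lam)" if "1 \<le> i" for i
    using assms that by (auto intro!: block_of_less_iff)
  ultimately show ?thesis by (auto simp: Suc_le_eq)
qed

lemma card_block:
  assumes "t < length lam"
  shows "card {i \<in> {1..sum_list lam}. block_of lam i = t} = lam ! t"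
  unfolding block_eq_interval[OF assms] using assms by (simp add: take_Suc_conv_app_nth)

lemma block_of_image:
  assumes "0 \<notin> set lam"
  shows "block_of lam ` {1..sum_list lam} = {0..<length lam}"
proof (intro equalityI subsetI)
  fix t assume "t \<in> block_of lam ` {1..sum_list lam}"
  then show "t \<in> {0..<length lam}" using block_of_less_iff[of _ "length lam" lam] by auto
next
  fix t assume t: "t \<in> {0..<length lam}"
  then have "0 < card {i \<in> {1..sum_list lam}. block_of lam i = t}"
    using assms card_block by (metis atLeastLessThan_iff gr0I nth_mem)
  then show "t \<in> block_of lam ` {1..sum_list lam}" by (auto simp: card_gt_0_iff)
qed

lemma bij_inv_permutes:
  assumes "d permutes {1..n}"
  shows "bij_betw (Hilbert_Choice.inv d) {1..n} {1..n}"
  using permutes_imp_bij[OF permutes_inv[OF assms]] .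

text \<open>The node of the value \<open>j\<close> gets number \<open>inv d j\<close> in the row
  filling and \<open>j\<close> in the column filling, so \<open>w_diag\<close> sends
  \<open>inv d j\<close> to \<open>j\<close>, as \<open>d\<close> does.\<close>

lemma valid_diagram:
  assumes comp: "0 \<notin> set lam" and d: "d \<in> X_J lam"
    and valid: "valid_cols (row_of lam d) (sum_list lam) c C"
  shows "diagram_of lam d c \<in> diagrams lam" and "w_diag (diagram_of lam d c) = d"
    and "num_cols (diagram_of lam d c) = C"
proof -
  let ?n = "sum_list lam" and ?d' = "Hilbert_Choice.inv d"
  let ?b = "row_of lam d" and ?D = "diagram_of lam d c"
  let ?node = "\<lambda>j. (Suc (?b j), c j)"
  have p: "d permutes {1..?n}" and inc:
    "\<And>i j. \<lbrakk>1 \<le> i; i < j; j \<le> ?n; block_of lam i = block_of lam j\<rbrakk> \<Longrightarrow> d i < d j"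
    using d by (auto simp: X_J_iff)
  note bij = bij_inv_permutes[OF p]
  have inv: "?d' (d i) = i" "d (?d' i) = i" for i using permutes_inverses[OF p] by auto
  have D: "?D = ?node ` {1..?n}" by (simp add: diagram_of_def)
  have vlt: "c j < c j' \<or> c j = c j' \<and> ?b j < ?b j'" if "1 \<le> j" "j < j'" "j' \<le> ?n" for j j'
    using valid that by (auto simp: valid_cols_def)
  have inj: "inj_on ?node {1..?n}"
  proof (rule linorder_inj_onI)
    fix i j assume "i < j" "i \<in> {1..?n}" "j \<in> {1..?n}"
    then show "?node i \<noteq> ?node j" using vlt[of i j] by auto
  qed (rule linear)
  have card_filter: "card {x \<in> ?D. P x} = card {j \<in> {1..?n}. P (?node j)}" for P
  proof -
    have "{x \<in> ?D. P x} = ?node ` {j \<in> {1..?n}. P (?node j)}" unfolding D by blast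
    moreover have "inj_on ?node {j \<in> {1..?n}. P (?node j)}" by (rule inj_on_subset[OF inj]) auto
    ultimately show ?thesis by (simp only: card_image)
  qed
  \<comment> \<open>Change of variable from values to positions, used together with
    \<open>card_filter\<close> to count nodes.\<close>
  have card_pos: "card {j \<in> {1..?n}. Q (?d' j)} = card {i \<in> {1..?n}. Q i}" for Q
  proof -
    have "?d' ` {j \<in> {1..?n}. Q (?d' j)} = {i \<in> ?d' ` {1..?n}. Q i}" by blast
    then have "{i \<in> {1..?n}. Q i} = ?d' ` {j \<in> {1..?n}. Q (?d' j)}"
      unfolding bij_betw_imp_surj_on[OF bij] by (rule sym)
    moreover have "inj_on ?d' {j \<in> {1..?n}. Q (?d' j)}"
      by (rule inj_on_subset[OF bij_betw_imp_inj_on[OF bij]]) auto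
    ultimately show ?thesis by (simp only: card_image)
  qed
  have cardD: "card ?D = ?n" using card_image[OF inj] by (simp add: D)
  have "?b ` {1..?n} = block_of lam ` (?d' ` {1..?n})" by (auto simp: row_of_def)
  also have "\<dots> = {0..<length lam}"
    using bij_betw_imp_surj_on[OF bij] block_of_image[OF comp] by simp
  finally have "Suc ` ?b ` {1..?n} = {1..length lam}"
    by (simp add: image_Suc_atLeastLessThan atLeastLessThanSuc_atLeastAtMost)
  then have fstD: "fst ` ?D = {1..length lam}" unfolding D by (simp add: image_image)
  have sndD: "snd ` ?D = {1..C}" using valid unfolding D by (simp add: image_image valid_cols_def)
  have "finite ?D" unfolding D by simp
  then have isD: "is_diagram ?D" using fstD sndD by (auto simp: is_diagram_def)
  show "num_cols ?D = C" by (simp add: num_cols_def sndD)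
  have "row_composition ?D = lam"
  proof (rule nth_equalityI)
    show len: "length (row_composition ?D) = length lam"
      by (simp add: row_composition_def num_rows_def fstD)
    fix t assume "t < length (row_composition ?D)"
    then have t: "t < length lam" using len by simp
    have "row_composition ?D ! t = card {x \<in> ?D. fst x = Suc t}"
      using t by (simp add: row_composition_def num_rows_def fstD)
    also have "\<dots> = card {j \<in> {1..?n}. block_of lam (?d' j) = t}"
      unfolding card_filter by (simp add: row_of_def)
    also have "\<dots> = lam ! t" using card_pos[of "\<lambda>i. block_of lam i = t"] card_block[OF t] by simp
    finally show "row_composition ?D ! t = lam ! t" .
  qed
  then show "?D \<in> diagrams lam" using isD by (simp add: diagrams_def)
  have rf: "row_filling ?D (?node j) = ?d' j" if j: "j \<in> {1..?n}" for j
  proof -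
    \<comment> \<open>Row-reading order is the order of positions: rows are blocks, and inside a
      block \<open>d\<close> increases, so columns follow positions.\<close>
    have key: "?b j' < ?b j \<or> ?b j' = ?b j \<and> c j' \<le> c j \<longleftrightarrow> ?d' j' \<le> ?d' j"
      if j': "j' \<in> {1..?n}" for j'
    proof -
      let ?i = "?d' j" and ?i' = "?d' j'"
      have r: "?i \<in> {1..?n}" "?i' \<in> {1..?n}" using bij j j' by (auto dest: bij_betwE)
      show ?thesis
      proof (cases "?i' \<le> ?i")
        case True
        have "?b j' \<le> ?b j" using block_of_mono[OF True] by (simp add: row_of_def)
        moreover have "c j' \<le> c j" if "?b j' = ?b j"
        proof (cases "?i' = ?i")
          case True
          then have "d ?i' = d ?i" by (rule arg_cong)
          then have "j' = j" unfolding inv .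
          then show ?thesis by simp
        next
          case False
          then have "d ?i' < d ?i" using inc[of ?i' ?i] r True that by (simp add: row_of_def)
          then show ?thesis using valid_cols_mono[OF valid, of j' j] j j' inv by simp
        qed
        ultimately show ?thesis using True by auto
      next
        case False
        then have "?b j \<le> ?b j'" using block_of_mono[of ?i ?i' lam] by (simp add: row_of_def)
        moreover have "c j < c j'" if "?b j' = ?b j"
        proof -
          have "d ?i < d ?i'" using inc[of ?i ?i'] r False that by (simp add: row_of_def)
          then show ?thesis using vlt[of j j'] j j' inv that by auto
        qed
        ultimately show ?thesis using False by auto
      qed
    qed
    have "row_filling ?D (?node j) = card {j' \<in> {1..?n}. ?b j' < ?b j \<or> ?b j' = ?b j \<and> c j' \<le> c j}"
      unfolding row_filling_def card_filter by simp
    also have "\<dots> = card {j' \<in> {1..?n}. ?d' j' \<le> ?d' j}"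
      using key by (intro arg_cong[where f = card] Collect_cong) blast
    also have "\<dots> = card {i \<in> {1..?n}. i \<le> ?d' j}" by (rule card_pos)
    also have "{i \<in> {1..?n}. i \<le> ?d' j} = {1..?d' j}"
      using bspec[OF bij_betwE[OF bij] j] by auto
    finally show ?thesis by simp
  qed
  have cf: "col_filling ?D (?node j) = j" if j: "j \<in> {1..?n}" for j
  proof -
    have key: "c j' < c j \<or> c j' = c j \<and> ?b j' \<le> ?b j \<longleftrightarrow> j' \<le> j" if "j' \<in> {1..?n}" for j'
    proof (cases j' j rule: linorder_cases)
      case less
      then show ?thesis using vlt[of j' j] that j by auto
    next
      case greater
      then show ?thesis using vlt[of j j'] that j by auto
    qed simp
    have "col_filling ?D (?node j) = card {j' \<in> {1..?n}. c j' < c j \<or> c j' = c j \<and> ?b j' \<le> ?b j}"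
      unfolding col_filling_def card_filter by simp
    also have "\<dots> = card {j' \<in> {1..?n}. j' \<le> j}"
      using key by (intro arg_cong[where f = card] Collect_cong) blast
    also have "{j' \<in> {1..?n}. j' \<le> j} = {1..j}" using j by auto
    finally show ?thesis by simp
  qed
  show "w_diag ?D = d"
    unfolding w_diag_def cardD
  proof (rule the_equality)
    show "d permutes {1..?n} \<and> (\<forall>x\<in>?D. d (row_filling ?D x) = col_filling ?D x)"
      using p rf cf inv by (auto simp: D simp del: One_nat_def)
    fix w assume w: "w permutes {1..?n} \<and> (\<forall>x\<in>?D. w (row_filling ?D x) = col_filling ?D x)"
    have "w i = d i" for i
    proof (cases "i \<in> {1..?n}")
      case True
      then have di: "d i \<in> {1..?n}" using permutes_in_image[OF p] by simp
      then have "?node (d i) \<in> ?D" unfolding D by (rule imageI)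
      then show ?thesis using w rf[OF di] cf[OF di] inv by metis
    next
      case False
      then show ?thesis using w p by (metis permutes_not_in)
    qed
    then show "w = d" by blast
  qed
qed

section \<open>From diagrams back to column assignments\<close>

lemma rank_bij:
  fixes le :: "'a \<Rightarrow> 'a \<Rightarrow> bool"
  assumes fin: "finite D" and tot: "\<And>x y. x \<in> D \<Longrightarrow> y \<in> D \<Longrightarrow> le x y \<or> le y x"
    and anti: "\<And>x y. le x y \<Longrightarrow> le y x \<Longrightarrow> x = y"
    and trans: "\<And>x y z. le x y \<Longrightarrow> le y z \<Longrightarrow> le x z"
  defines "r \<equiv> \<lambda>x. card {y \<in> D. le y x}"
  shows "bij_betw r D {1..card D}"
    and "\<And>x y. x \<in> D \<Longrightarrow> y \<in> D \<Longrightarrow> r x < r y \<Longrightarrow> le x y"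
proof -
  have less: "r x < r y" if "x \<in> D" "y \<in> D" "le x y" "x \<noteq> y" for x y
  proof -
    have "y \<notin> {z \<in> D. le z x}" using that anti by blast
    moreover have "y \<in> {z \<in> D. le z y}" using that tot by blast
    moreover have "{z \<in> D. le z x} \<subseteq> {z \<in> D. le z y}" using that trans by blast
    ultimately have "{z \<in> D. le z x} \<subset> {z \<in> D. le z y}" by blast
    then show ?thesis unfolding r_def using fin by (intro psubset_card_mono) auto
  qed
  have inj: "inj_on r D"
    using less tot by (intro inj_onI) (metis less_irrefl)
  have "r ` D \<subseteq> {1..card D}"
  proof (rule image_subsetI)
    fix x assume x: "x \<in> D"
    then have "x \<in> {y \<in> D. le y x}" using tot by blast
    then have "0 < r x" unfolding r_def using fin by (auto simp: card_gt_0_iff)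
    moreover have "r x \<le> card D" unfolding r_def using fin by (intro card_mono) auto
    ultimately show "r x \<in> {1..card D}" by simp
  qed
  moreover have "card (r ` D) = card {1..card D}" using inj by (simp add: card_image)
  ultimately have "r ` D = {1..card D}" by (intro card_subset_eq) auto
  then show "bij_betw r D {1..card D}" using inj by (simp add: bij_betw_def)
  show "le x y" if "x \<in> D" "y \<in> D" "r x < r y" for x y
  proof (rule ccontr)
    assume "\<not> le x y"
    then have "le y x" "x \<noteq> y" using tot that by blast+
    then show False using less[of y x] that by simp
  qed
qed

lemma row_filling_bij: "finite D \<Longrightarrow> bij_betw (row_filling D) D {1..card D}"
  unfolding row_filling_def by (rule rank_bij(1)) (auto simp: prod_eq_iff)

lemma col_filling_bij: "finite D \<Longrightarrow> bij_betw (col_filling D) D {1..card D}"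
  unfolding col_filling_def by (rule rank_bij(1)) (auto simp: prod_eq_iff)

lemma col_filling_less:
  assumes "finite D" "x \<in> D" "y \<in> D" "col_filling D x < col_filling D y"
  shows "snd x < snd y \<or> snd x = snd y \<and> fst x < fst y"
proof -
  have "snd x < snd y \<or> snd x = snd y \<and> fst x \<le> fst y"
    by (rule rank_bij(2)[OF assms(1) _ _ _ assms(2,3)])
      (use assms(4) in \<open>auto simp: prod_eq_iff col_filling_def\<close>)
  moreover have "x \<noteq> y" using assms(4) by auto
  ultimately show ?thesis by (auto simp: prod_eq_iff)
qed

text \<open>Justifies the definite description: the inverse row filling followed by the column
  filling, extended by the identity, is the one permutation that fits.\<close>

lemma w_diag_spec:
  assumes "finite D"
  shows "w_diag D permutes {1..card D} \<and> (\<forall>x\<in>D. w_diag D (row_filling D x) = col_filling D x)"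
proof -
  let ?n = "card D" and ?r = "row_filling D" and ?c = "col_filling D"
  note r = row_filling_bij[OF assms] and c = col_filling_bij[OF assms]
  let ?g = "?c \<circ> inv_into D ?r"
  let ?w = "\<lambda>i. if i \<in> {1..?n} then ?g i else i"
  have "bij_betw ?g {1..?n} {1..?n}" by (rule bij_betw_trans[OF bij_betw_inv_into[OF r] c])
  then have "bij_betw ?w {1..?n} {1..?n}" by (rule iffD1[OF bij_betw_cong, rotated]) simp
  then have perm: "?w permutes {1..?n}" using bij_imp_permutes[of ?w "{1..?n}"] by (metis (no_types))
  have val: "?w (?r x) = ?c x" if "x \<in> D" for x
    using that r bij_betwE[OF r] by (auto simp: bij_betw_inv_into_left simp del: One_nat_def)
  let ?P = "\<lambda>w. w permutes {1..?n} \<and> (\<forall>x\<in>D. w (?r x) = ?c x)"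
  have "?P (THE w. ?P w)"
  proof (rule theI[of ?P ?w])
    show "?P ?w" using perm val by blast
    fix w assume w: "w permutes {1..?n} \<and> (\<forall>x\<in>D. w (?r x) = ?c x)"
    show "w = ?w"
    proof
      fix i
      show "w i = ?w i"
      proof (cases "i \<in> {1..?n}")
        case True
        then obtain x where "x \<in> D" "i = ?r x" using bij_betw_imp_surj_on[OF r] by blast
        then show ?thesis using w val by metis
      next
        case False
        then show ?thesis using w by (metis permutes_not_in)
      qed
    qed
  qed
  then show ?thesis unfolding w_diag_def .
qed

lemma diagram_rows:
  assumes "D \<in> diagrams lam"
  shows "fst ` D = {1..length lam}"
    and "t \<le> length lam \<Longrightarrow> card {x \<in> D. fst x \<le> t} = sum_list (take t lam)"
    and "card D = sum_list lam"
proof -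
  have fin: "finite D" and comp: "row_composition D = lam"
    using assms by (auto simp: diagrams_def is_diagram_def)
  obtain r where r: "fst ` D = {1..r}" using assms by (auto simp: diagrams_def is_diagram_def)
  then have "length (row_composition D) = r" by (simp add: row_composition_def num_rows_def)
  then show f: "fst ` D = {1..length lam}" using r comp by simp
  have row: "card {x \<in> D. fst x = Suc t} = lam ! t" if "t < length lam" for t
  proof -
    have "row_composition D ! t = card {x \<in> D. fst x = Suc t}"
      using that f by (simp add: row_composition_def num_rows_def)
    then show ?thesis using comp by simp
  qed
  show le: "card {x \<in> D. fst x \<le> t} = sum_list (take t lam)" if "t \<le> length lam" for t
    using that
  proof (induction t)
    case 0
    have "{x \<in> D. fst x \<le> 0} = {}" using f by force
    then show ?case by (simp only: card.empty take_0 sum_list.Nil)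
  next
    case (Suc t)
    have "{x \<in> D. fst x \<le> Suc t} = {x \<in> D. fst x \<le> t} \<union> {x \<in> D. fst x = Suc t}" by auto
    moreover have "card ({x \<in> D. fst x \<le> t} \<union> {x \<in> D. fst x = Suc t}) =
        card {x \<in> D. fst x \<le> t} + card {x \<in> D. fst x = Suc t}"
      by (rule card_Un_disjoint) (use fin in auto)
    ultimately show ?case using Suc row[of t] by (simp add: take_Suc_conv_app_nth)
  qed
  have "{x \<in> D. fst x \<le> length lam} = D" using f by force
  then show "card D = sum_list lam" using le[of "length lam"] by simp
qed

text \<open>The number of a node in row \<open>Suc t\<close> exceeds the number of nodes in the
  first \<open>t\<close> rows and is at most that of the first \<open>Suc t\<close> rows; these
  counts are the partial sums of \<open>lam\<close>.\<close>

lemma block_of_row_filling: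
  assumes D: "D \<in> diagrams lam" and x: "x \<in> D"
  shows "fst x = Suc (block_of lam (row_filling D x))"
proof -
  have fin: "finite D" using D by (auto simp: diagrams_def is_diagram_def)
  have "fst x \<in> {1..length lam}" using diagram_rows(1)[OF D] x by blast
  then obtain t where t: "fst x = Suc t" "t < length lam" by (cases "fst x") auto
  have pos: "1 \<le> row_filling D x" using row_filling_bij[OF fin] x by (auto dest!: bij_betwE)
  have "row_filling D x \<le> card {y \<in> D. fst y \<le> Suc t}"
    unfolding row_filling_def using fin t by (intro card_mono) auto
  then have "block_of lam (row_filling D x) < Suc t"
    using block_of_less_iff[of "row_filling D x" "Suc t" lam] pos t diagram_rows(2)[OF D] by simp
  moreover have "card {y \<in> D. fst y \<le> t} < row_filling D x"
    unfolding row_filling_def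
  proof (rule psubset_card_mono)
    let ?B = "{y \<in> D. fst y < fst x \<or> fst y = fst x \<and> snd y \<le> snd x}"
    have "x \<in> ?B" "x \<notin> {y \<in> D. fst y \<le> t}" using x t by auto
    moreover have "{y \<in> D. fst y \<le> t} \<subseteq> ?B" using t by auto
    ultimately show "{y \<in> D. fst y \<le> t} \<subset> ?B" by blast
  qed (use fin in simp)
  then have "\<not> block_of lam (row_filling D x) < t"
    using block_of_less_iff[of "row_filling D x" t lam] pos t diagram_rows(2)[OF D, of t] by simp
  ultimately show ?thesis using t by simp
qed

text \<open>The converse of \<open>valid_diagram\<close>: the assignment sends \<open>j\<close> to
  the column of the node with column number \<open>j\<close>.\<close>

lemma diagram_valid:
  assumes D: "D \<in> diagrams lam"
  shows "\<exists>c. valid_cols (row_of lam (w_diag D)) (sum_list lam) c (num_cols D) \<and>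
    D = diagram_of lam (w_diag D) c"
proof -
  let ?n = "sum_list lam" and ?d = "w_diag D"
  have fin: "finite D" using D by (auto simp: diagrams_def is_diagram_def)
  obtain C where C: "snd ` D = {1..C}" using D by (auto simp: diagrams_def is_diagram_def)
  have n: "card D = ?n" using diagram_rows(3)[OF D] .
  have p: "?d permutes {1..?n}" and d: "\<And>x. x \<in> D \<Longrightarrow> ?d (row_filling D x) = col_filling D x"
    using w_diag_spec[OF fin] n by auto
  define x where "x = inv_into D (col_filling D)"
  note bij = col_filling_bij[OF fin, unfolded n]
  have x: "x j \<in> D" "col_filling D (x j) = j" if "j \<in> {1..?n}" for j
    using that bij unfolding x_def
    by (auto intro: inv_into_into f_inv_into_f simp: bij_betw_def simp del: One_nat_def)
  have xD: "x ` {1..?n} = D"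
    using bij_betw_imp_surj_on[OF bij_betw_inv_into[OF bij]] by (simp add: x_def)
  have row: "Suc (row_of lam ?d j) = fst (x j)" if j: "j \<in> {1..?n}" for j
  proof -
    have "Hilbert_Choice.inv ?d j = row_filling D (x j)"
      using d[OF x(1)[OF j]] x(2)[OF j] permutes_inverses[OF p] by metis
    then show ?thesis using block_of_row_filling[OF D x(1)[OF j]] by (simp add: row_of_def)
  qed
  have "D = diagram_of lam ?d (snd \<circ> x)"
    unfolding diagram_of_def using row by (subst xD[symmetric]) (auto intro!: image_cong)
  moreover have "valid_cols (row_of lam ?d) ?n (snd \<circ> x) (num_cols D)"
    unfolding valid_cols_def
  proof (intro conjI allI impI)
    show "(snd \<circ> x) ` {1..?n} = {1..num_cols D}"
    proof -
      have "(snd \<circ> x) ` {1..?n} = snd ` D" unfolding xD[symmetric] by (simp add: image_comp)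
      then show ?thesis using C by (simp add: num_cols_def)
    qed
    fix j j' assume "1 \<le> j" "j < j'" "j' \<le> ?n"
    then have r: "j \<in> {1..?n}" "j' \<in> {1..?n}" by auto
    have "snd (x j) < snd (x j') \<or> snd (x j) = snd (x j') \<and> fst (x j) < fst (x j')"
      using col_filling_less[OF fin x(1)[OF r(1)] x(1)[OF r(2)]] x(2) r \<open>j < j'\<close> by simp
    then show "(snd \<circ> x) j < (snd \<circ> x) j' \<or>
        (snd \<circ> x) j = (snd \<circ> x) j' \<and> row_of lam ?d j < row_of lam ?d j'"
      using row[OF r(1)] row[OF r(2)] by auto
  qed
  ultimately show ?thesis by blast
qed

text \<open>Diagrams with \<open>w_diag D = d\<close> are those of valid column assignments, and by
  \<open>min_cols_le\<close> the greedy one alone has the fewest columns.\<close>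

lemma min_diagram_eq:
  assumes "0 \<notin> set lam" "d \<in> X_J lam" "1 \<le> sum_list lam"
  shows "min_diagram d lam = diagram_of lam d (min_cols (row_of lam d))"
  unfolding min_diagram_def
proof (rule the_equality)
  let ?n = "sum_list lam" and ?c = "min_cols (row_of lam d)"
  note v = valid_diagram[OF assms(1,2) valid_cols_min_cols]
  show "diagram_of lam d ?c \<in> diagrams lam \<and> w_diag (diagram_of lam d ?c) = d \<and>
    (\<forall>E\<in>diagrams lam. w_diag E = d \<longrightarrow> num_cols (diagram_of lam d ?c) \<le> num_cols E)"
  proof (intro conjI ballI impI)
    fix E assume "E \<in> diagrams lam" "w_diag E = d"
    then obtain c where "valid_cols (row_of lam d) ?n c (num_cols E)" using diagram_valid by blast
    then show "num_cols (diagram_of lam d ?c) \<le> num_cols E"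
      using min_cols_le(1) assms(3) v(3) by simp
  qed (use v in auto)
  fix D assume D: "D \<in> diagrams lam \<and> w_diag D = d \<and>
    (\<forall>E\<in>diagrams lam. w_diag E = d \<longrightarrow> num_cols D \<le> num_cols E)"
  then obtain c where c: "valid_cols (row_of lam d) ?n c (num_cols D)" "D = diagram_of lam d c"
    using diagram_valid by blast
  have "num_cols D \<le> ?c ?n" using D v by metis
  then have "c j = ?c j" if "j \<in> {1..?n}" for j using min_cols_le(2)[OF c(1) assms(3)] that by blast
  then show "D = diagram_of lam d ?c" unfolding c(2) diagram_of_def by (intro image_cong) auto
qed

section \<open>Incrementing a part\<close>

text \<open>The product of \<open>s a\<close> up to \<open>s n\<close> in closed form, the identity
  for \<open>a = Suc n\<close>. It serves as both factors of the theorem, acting on positions, and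
  later as a relabelling of letters.\<close>

definition cycle_up :: "nat \<Rightarrow> nat \<Rightarrow> nat \<Rightarrow> nat"
  where "cycle_up a n i = (if i < a \<or> Suc n < i then i else if i = a then Suc n else i - 1)"

lemma word_prod_upt: "a \<le> Suc n \<Longrightarrow> word_prod [a..<Suc n] = cycle_up a n"
proof (induction rule: inc_induct)
  case base
  show ?case by (auto simp: cycle_up_def)
next
  case (step a)
  then have "word_prod [a..<Suc n] = s a \<cdot> cycle_up (Suc a) n" by (simp add: upt_conv_Cons)
  moreover have "(s a \<cdot> cycle_up (Suc a) n) i = cycle_up a n i" for i
    using step(1,2)
    by (cases "i = a"; cases "i = Suc a") (auto simp: rmul_apply s_simps cycle_up_def)
  ultimately show ?case by auto
qed

lemma cycle_up_permutes:
  assumes "1 \<le> a" "a \<le> Suc n"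
  shows "cycle_up a n permutes {1..Suc n}"
  using word_prod_permutes[of "[a..<Suc n]" "Suc n"] assms by (simp add: word_prod_upt)

lemma cycle_up_less:
  "\<lbrakk>x < y; y \<le> Suc n; x \<noteq> a; y \<noteq> a\<rbrakk> \<Longrightarrow> cycle_up a n x < cycle_up a n y"
  by (auto simp: cycle_up_def)

lemma permutes_fix_last:
  assumes "w permutes {1..Suc n}" "w (Suc n) = Suc n"
  shows "w permutes {1..n}"
  by (rule permutes_superset[OF assms(1)]) (use assms(2) in \<open>auto simp: le_Suc_eq\<close>)

lemma permutes_Suc: "w permutes {1..n} \<Longrightarrow> w permutes {1..Suc n}" for n :: nat
  by (rule permutes_subset) auto

lemma sum_list_split_at:
  "\<lbrakk>1 \<le> i; i \<le> sum_list ks\<rbrakk> \<Longrightarrow>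
    \<exists>ks1 l ks2. ks = ks1 @ l # ks2 \<and> sum_list ks1 < i \<and> i \<le> sum_list ks1 + l" for ks :: "nat list"
proof (induction ks arbitrary: i)
  case (Cons l ks)
  show ?case
  proof (cases "i \<le> l")
    case True
    then show ?thesis using Cons.prems by (intro exI[of _ "[]"] exI[of _ l] exI[of _ ks]) simp
  next
    case False
    then have "1 \<le> i - l" "i - l \<le> sum_list ks" using Cons.prems by auto
    then obtain ks1 l' ks2 where "ks = ks1 @ l' # ks2" "sum_list ks1 < i - l"
        "i - l \<le> sum_list ks1 + l'"
      using Cons.IH by blast
    then show ?thesis using False
      by (intro exI[of _ "l # ks1"] exI[of _ l'] exI[of _ ks2]) auto
  qed
qed simp

text \<open>Here \<open>m\<close> is the part to be incremented, and \<open>ks\<close> and \<open>ls\<close> are the parts before and after it;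
  multiplying by \<open>delta\<close> inserts the letter \<open>n + 1\<close> at the end of the block of \<open>m\<close>.\<close>

locale incremented_part =
  fixes ks ls :: "nat list" and m :: nat
begin

abbreviation "lam \<equiv> ks @ m # ls"
abbreviation "lam' \<equiv> ks @ Suc m # ls"
abbreviation "n \<equiv> sum_list lam"
abbreviation "q \<equiv> sum_list ks"
abbreviation "p \<equiv> q + m"
abbreviation "delta \<equiv> cycle_up (Suc p) n"
text \<open>Enumerates the positions other than \<open>Suc p\<close> in increasing order;
  \<open>delta\<close> undoes it.\<close>

abbreviation "skip i \<equiv> (if i \<le> p then i else Suc i)"

lemma sum_lam': "sum_list lam' = Suc n"
  by simp

lemma delta_permutes: "delta permutes {1..Suc n}"
  by (rule cycle_up_permutes) auto

lemma delta_permutes_rmul: "y permutes {1..n} \<Longrightarrow> delta \<cdot> y permutes {1..Suc n}"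
  by (rule rmul_permutes[OF delta_permutes permutes_Suc])

lemma delta_skip: "i \<le> n \<Longrightarrow> delta (skip i) = i"
  by (auto simp: cycle_up_def)

lemma delta_p: "delta (Suc p) = Suc n"
  by (auto simp: cycle_up_def)

lemma skip_cases:
  assumes "i \<in> {1..Suc n}"
  obtains "i = Suc p" | i' where "i' \<in> {1..n}" "i = skip i'"
proof (cases "i \<le> p")
  case True
  then show ?thesis using assms that(2)[of i] by auto
next
  case False
  show ?thesis
  proof (cases "i = Suc p")
    case True
    then show ?thesis by (rule that(1))
  next
    case False
    then have "i - 1 \<in> {1..n}" "i = skip (i - 1)" using assms \<open>\<not> i \<le> p\<close> by auto
    then show ?thesis by (rule that(2))
  qed
qed

lemma skip_less [simp]: "skip i < skip j \<longleftrightarrow> i < j"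
  by auto

lemma block_of_skip: "1 \<le> i \<Longrightarrow> i \<le> n \<Longrightarrow> block_of lam' (skip i) = block_of lam i"
  by (subst (1 2) block_of_append) auto

lemma block_of_p: "block_of lam' (Suc p) = length ks"
  by (subst block_of_append) auto

lemma block_of_skip_eq_p:
  assumes "i \<in> {1..n}" "block_of lam' (skip i) = length ks"
  shows "i \<le> p"
proof (rule ccontr)
  assume "\<not> i \<le> p"
  moreover from this have "block_of lam' (Suc i) = length ks + block_of (Suc m # ls) (Suc i - q)"
    using assms(1) by (subst block_of_append) auto
  ultimately show False using assms(2) by (auto split: if_splits)
qed

lemma X_J_delta:
  assumes z: "z \<in> X_J lam"
  shows "delta \<cdot> z \<in> X_J lam'"
proof -
  have p: "z permutes {1..n}" and inc: "\<And>i j. \<lbrakk>1 \<le> i; i < j; j \<le> n; block_of lam i = block_of lam j\<rbrakk>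
      \<Longrightarrow> z i < z j"
    using z by (auto simp: X_J_iff)
  show ?thesis
    unfolding X_J_iff sum_lam'
  proof (intro conjI allI impI)
    show "delta \<cdot> z permutes {1..Suc n}" by (rule delta_permutes_rmul[OF p])
    fix i j assume ij: "1 \<le> i" "i < j" "j \<le> Suc n" "block_of lam' i = block_of lam' j"
    then have r: "i \<in> {1..Suc n}" "j \<in> {1..Suc n}" by auto
    show "(delta \<cdot> z) i < (delta \<cdot> z) j"
    proof (rule skip_cases[OF r(1)])
      assume i: "i = Suc p"
      show ?thesis
      proof (rule skip_cases[OF r(2)])
        fix j' assume "j' \<in> {1..n}" "j = skip j'"
        then have "j' \<le> p" using block_of_skip_eq_p ij(4) i block_of_p by metis
        then show ?thesis using \<open>j = skip j'\<close> i ij by simp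
      qed (use i ij in simp)
    next
      fix i' assume i': "i' \<in> {1..n}" "i = skip i'"
      then have i: "(delta \<cdot> z) i = z i'" using delta_skip[of i'] by (simp add: rmul_apply)
      show ?thesis
      proof (rule skip_cases[OF r(2)])
        assume "j = Suc p"
        then have "(delta \<cdot> z) j = Suc n"
          using delta_p permutes_gt[OF p, of "Suc n"] by (simp add: rmul_apply)
        then show ?thesis using i permutes_le[OF p, of i'] i'(1) by simp
      next
        fix j' assume j': "j' \<in> {1..n}" "j = skip j'"
        then have j: "(delta \<cdot> z) j = z j'" using delta_skip[of j'] by (simp add: rmul_apply)
        have "block_of lam i' = block_of lam j'"
          using block_of_skip[of i'] block_of_skip[of j'] i' j' ij(4) by simp
        moreover have "i' < j'" using ij(2) unfolding i'(2) j'(2) by simp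
        ultimately show ?thesis unfolding i j using inc i' j' by simp
      qed
    qed
  qed
qed

text \<open>Only the relative order of \<open>v\<close> away from \<open>Suc p\<close> enters, so
  this serves for \<open>v = delta \<cdot> y\<close> as well as for a \<open>y\<close> obtained by
  relabelling the values of \<open>v\<close>.\<close>

lemma X_J_skip:
  assumes y: "y permutes {1..n}" and v: "v \<in> X_J lam'"
    and mono: "\<And>i j. \<lbrakk>i \<in> {1..n}; j \<in> {1..n}; v (skip i) < v (skip j)\<rbrakk> \<Longrightarrow> y i < y j"
  shows "y \<in> X_J lam"
  unfolding X_J_iff
proof (intro conjI allI impI)
  show "y permutes {1..n}" by (rule y)
  fix i j assume ij: "1 \<le> i" "i < j" "j \<le> n" "block_of lam i = block_of lam j"
  have "block_of lam' (skip i) = block_of lam' (skip j)"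
    using block_of_skip[of i] block_of_skip[of j] ij by simp
  moreover have "skip i < skip j" using ij(2) by simp
  moreover have "1 \<le> skip i" "skip j \<le> sum_list lam'" using ij by auto
  ultimately have "v (skip i) < v (skip j)" using v unfolding X_J_iff by blast
  then show "y i < y j" using mono ij by simp
qed

section \<open>Inserting and deleting the letter \<open>Suc n\<close> in words of cells\<close>

lemma dec_word_lam: "dec_word lam 0 z = dec_word ks 0 z @ rev (map z [Suc q..<Suc p]) @ dec_word ls p z"
  by (simp add: dec_word_append)

lemma dec_word_lam':
  "dec_word lam' 0 v = dec_word ks 0 v @ v (Suc p) # rev (map v [Suc q..<Suc p]) @ dec_word ls (Suc p) v"
  by (simp add: dec_word_append upt_Suc_append)

text \<open>Blocks are read backwards, so a value placed at the end of the block of \<open>m\<close>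
  becomes the letter in front of it; it is \<open>Suc n\<close> for \<open>z\<close> in the smaller
  group.\<close>

lemma dec_word_delta:
  "dec_word lam' 0 (delta \<cdot> z) =
    dec_word ks 0 z @ z (Suc n) # rev (map z [Suc q..<Suc p]) @ dec_word ls p z"
proof -
  have "dec_word ks 0 (delta \<cdot> z) = dec_word ks 0 z"
    using dec_word_cong[of 0 ks "delta \<cdot> z" 0 z 0] by (auto simp: rmul_apply cycle_up_def)
  moreover have "map (delta \<cdot> z) [Suc q..<Suc p] = map z [Suc q..<Suc p]"
    by (rule map_cong) (auto simp: rmul_apply cycle_up_def)
  \<comment> \<open>Later positions move by one; \<open>p + 1\<close> and \<open>p + 0\<close> fit
    the shifts of \<open>dec_word_cong\<close>.\<close>
  moreover have "dec_word ls (p + 1) (delta \<cdot> z) = dec_word ls (p + 0) z"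
    by (rule dec_word_cong) (auto simp: rmul_apply cycle_up_def)
  moreover have "(delta \<cdot> z) (Suc p) = z (Suc n)" using delta_p by (simp add: rmul_apply)
  ultimately show ?thesis unfolding dec_word_lam' by simp
qed

lemma letters_le:
  assumes "z permutes {1..n}"
  shows "\<forall>y\<in>set (dec_word ks 0 z) \<union> set (rev (map z [Suc q..<Suc p]) @ dec_word ls p z). y < Suc n"
proof
  fix y assume "y \<in> set (dec_word ks 0 z) \<union> set (rev (map z [Suc q..<Suc p]) @ dec_word ls p z)"
  then obtain j where "y = z j" "j \<le> n" by (auto simp: set_dec_word)
  then show "y < Suc n" using permutes_le[OF assms, of j] by simp
qed

lemma Z_delta:
  assumes z: "z \<in> Z lam" and le: "\<forall>l\<in>set ls. l \<le> m"
  shows "delta \<cdot> z \<in> Z lam'"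
proof -
  have p: "z permutes {1..n}" using z by (simp add: Z_iff X_J_iff)
  have "growth (dec_word ks 0 z @ rev (map z [Suc q..<Suc p]) @ dec_word ls p z) [] =
      canonical (ks @ m # ls)"
    using z unfolding Z_iff dec_word_lam by blast
  from growth_insert_large[OF letters_le[OF p] this length_dec_word le]
  have "growth (dec_word lam' 0 (delta \<cdot> z)) [] = canonical lam'"
    unfolding dec_word_delta permutes_gt[OF p lessI] .
  then show ?thesis using X_J_delta z by (simp only: Z_iff)
qed

text \<open>Cancelling \<open>delta\<close> moves the value \<open>Suc n\<close> from position
  \<open>Suc p\<close> to position \<open>Suc n\<close>, which is then fixed.\<close>

lemma delta_quotient:
  assumes v: "v permutes {1..Suc n}" "v (Suc p) = Suc n"
  obtains y where "y permutes {1..n}" "v = delta \<cdot> y"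
proof
  let ?y = "Hilbert_Choice.inv delta \<cdot> v"
  have inv: "Hilbert_Choice.inv delta (delta i) = i" for i
    using permutes_inverses[OF delta_permutes] by simp
  show "v = delta \<cdot> ?y" by (rule ext) (simp only: rmul_apply inv)
  have "?y permutes {1..Suc n}" using permutes_inv[OF delta_permutes] v(1) by (rule rmul_permutes)
  moreover have "?y (Suc n) = Suc n" using inv[of "Suc p"] delta_p v(2) by (simp add: rmul_apply)
  ultimately show "?y permutes {1..n}" by (rule permutes_fix_last)
qed

lemma Z_delta_inverse:
  assumes y: "y permutes {1..n}" and v: "delta \<cdot> y \<in> Z lam'"
    and R: "\<forall>l\<in>set ks. l \<le> R" "R = 0 \<or> (\<exists>l\<in>set ls. R \<le> l)"
  shows "y \<in> Z lam"
proof -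
  have "growth (dec_word ks 0 y @ Suc n # rev (map y [Suc q..<Suc p]) @ dec_word ls p y) [] =
      canonical lam'"
    using v unfolding Z_iff dec_word_delta permutes_gt[OF y lessI] by blast
  from growth_remove_large(2)[OF letters_le[OF y] this length_dec_word R]
  have "growth (dec_word lam 0 y) [] = canonical lam" unfolding dec_word_lam .
  moreover have "y \<in> X_J lam"
  proof (rule X_J_skip[OF y, of "delta \<cdot> y"])
    show "delta \<cdot> y \<in> X_J lam'" using v by (simp only: Z_iff)
    fix i j assume "i \<in> {1..n}" "j \<in> {1..n}" "(delta \<cdot> y) (skip i) < (delta \<cdot> y) (skip j)"
    then show "y i < y j" using delta_skip[of i] delta_skip[of j] by (simp only: rmul_apply) simp
  qed
  ultimately show ?thesis by (simp only: Z_iff)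
qed

text \<open>By \<open>growth_remove_large\<close>, no block after the one containing the letter \<open>n + 1\<close> is as long as
  that block; so \<open>n + 1\<close> cannot precede the longest block.\<close>

lemma Z_last_value:
  assumes v: "v \<in> Z lam'" and dom: "\<And>j. \<lbrakk>Suc p < j; j \<le> Suc n\<rbrakk> \<Longrightarrow> v j < v (Suc p)"
    and le: "\<forall>l\<in>set ks. l \<le> m"
  shows "v (Suc p) = Suc n"
proof -
  have X: "v \<in> X_J lam'" and gr: "growth (dec_word lam' 0 v) [] = canonical lam'"
    using v by (auto simp only: Z_iff)
  have perm: "v permutes {1..Suc n}" using X by (simp only: X_J_iff sum_lam')
  have inc: "v i < v j" if "1 \<le> i" "i < j" "j \<le> Suc n" "block_of lam' i = block_of lam' j" for i j
    using X that unfolding X_J_iff sum_lam' by blast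
  have le_n: "v i \<le> Suc n" if "i \<le> Suc n" for i using permutes_le[OF perm that] .
  define i where "i = Hilbert_Choice.inv v (Suc n)"
  have vi: "v i = Suc n" unfolding i_def using permutes_inverses[OF perm] by simp
  have i: "1 \<le> i" "i \<le> Suc n"
    using permutes_in_image[OF perm, of i] vi by auto
  consider "i = Suc p" | "Suc p < i" | "q < i" "i < Suc p" | "i \<le> q" by linarith
  then show ?thesis
  proof cases
    case 1
    then show ?thesis using vi by simp
  next
    case 2
    then have "Suc n < v (Suc p)" using dom[of i] vi i by simp
    then show ?thesis using le_n[of "Suc p"] by simp
  next
    case 3
    then have "block_of lam' i = block_of lam' (Suc p)"
      unfolding block_of_p using i by (subst block_of_append) auto
    then have "Suc n < v (Suc p)" using inc[of i "Suc p"] 3 vi i by simp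
    then show ?thesis using le_n[of "Suc p"] by simp
  next
    case 4
    obtain ks1 l ks2 where ks: "ks = ks1 @ l # ks2" "sum_list ks1 < i" "i \<le> sum_list ks1 + l"
      using sum_list_split_at[OF i(1) 4] by blast
    let ?e = "sum_list ks1 + l" and ?ls = "ks2 @ Suc m # ls"
    have lam': "lam' = ks1 @ l # ?ls" using ks by simp
    have "block_of (ks1 @ l # ?ls) i = block_of (ks1 @ l # ?ls) ?e"
      using ks by (subst (1 2) block_of_append) auto
    \<comment> \<open>The largest value must sit at the end of its block, because \<open>v\<close>
      increases on blocks.\<close>
    then have "i = ?e"
      using inc[of i ?e] ks i le_n[of ?e] vi unfolding lam' by fastforce
    then have e: "v ?e = Suc n" using vi by simp
    obtain l' where l': "l = Suc l'" using ks by (cases l) auto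
    let ?us = "dec_word ks1 0 v"
    let ?ws = "rev (map v [Suc (sum_list ks1)..<?e]) @ dec_word ?ls ?e v"
    have "dec_word lam' 0 v = ?us @ Suc n # ?ws"
      unfolding lam' using l' e by (simp add: dec_word_append upt_Suc_append)
    then have "growth (?us @ Suc n # ?ws) [] = canonical lam'" using gr by (simp only:)
    then have gr': "growth (?us @ Suc n # ?ws) [] = canonical (ks1 @ Suc l' # ?ls)"
      unfolding lam' l' .
    have other: "v j < Suc n" if "j \<le> Suc n" "j \<noteq> ?e" for j
      using le_n[OF that(1)] e permutes_inj[OF perm] that(2) by (metis injD le_neq_implies_less)
    have "\<forall>y\<in>set ?us \<union> set ?ws. y < Suc n"
    proof
      fix y assume "y \<in> set ?us \<union> set ?ws"
      then obtain j where "y = v j" "j \<le> Suc n" "j \<noteq> ?e"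
        using ks l' by (auto simp: set_dec_word)
      then show "y < Suc n" using other by simp
    qed
    \<comment> \<open>With \<open>Suc n\<close> heading the block of \<open>l\<close>, all later
      parts are at most \<open>l'\<close>; the later part \<open>Suc m\<close> contradicts
      \<open>l \<le> m\<close>.\<close>
    from growth_remove_large(1)[OF this gr' length_dec_word] have "Suc m \<le> l'" by auto
    moreover have "l \<le> m" using le ks by simp
    ultimately show ?thesis using l' by simp
  qed
qed

section \<open>Prefixes and maximal elements\<close>

lemma inversions_delta_skip:
  assumes "i \<in> {1..n}" "j \<in> {1..n}"
  shows "(skip i, skip j) \<in> inversions (delta \<cdot> z) \<longleftrightarrow> (i, j) \<in> inversions z"
  using assms delta_skip[of i] delta_skip[of j] unfolding inversions_def rmul_apply by auto

lemma inversions_delta_p: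
  assumes "z permutes {1..n}"
  shows "(Suc p, j) \<in> inversions (delta \<cdot> z) \<longleftrightarrow> Suc p < j \<and> j \<le> Suc n"
    and "(i, Suc p) \<notin> inversions (delta \<cdot> z)"
proof -
  let ?v = "delta \<cdot> z"
  have vp: "?v (Suc p) = Suc n" using delta_p permutes_gt[OF assms lessI] by (simp add: rmul_apply)
  have perm: "?v permutes {1..Suc n}" by (rule delta_permutes_rmul[OF assms])
  have "?v j < ?v (Suc p)" if "Suc p < j" "j \<le> Suc n" for j
  proof -
    have "?v j \<noteq> ?v (Suc p)" using permutes_inj[OF perm] that(1) by (metis injD less_irrefl)
    then show ?thesis using permutes_le[OF perm that(2)] vp by simp
  qed
  moreover have "j \<le> Suc n" if "(Suc p, j) \<in> inversions ?v"
    using that inversions_subset[OF perm] by auto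
  ultimately show "(Suc p, j) \<in> inversions ?v \<longleftrightarrow> Suc p < j \<and> j \<le> Suc n"
    by (auto simp: inversions_def)
  show "(i, Suc p) \<notin> inversions ?v"
  proof
    assume a: "(i, Suc p) \<in> inversions ?v"
    then have "i \<le> Suc n" using inversions_subset[OF perm] by auto
    then show False using a permutes_le[OF perm, of i] vp by (simp add: inversions_def)
  qed
qed

text \<open>Inversions away from \<open>Suc p\<close> correspond under \<open>skip\<close> to those
  of the original permutation, and those at \<open>Suc p\<close> are the same for all permutations
  of \<open>{1..n}\<close>.\<close>

lemma prefix_delta_iff:
  assumes "y permutes {1..n}" "z permutes {1..n}"
  shows "is_prefix (Suc n) (delta \<cdot> y) (delta \<cdot> z) \<longleftrightarrow> is_prefix n y z"
  unfolding is_prefix_iff[OF assms] is_prefix_iff[OF delta_permutes_rmul[OF assms(1)]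
      delta_permutes_rmul[OF assms(2)]]
proof (intro iffI subrelI)
  fix i j assume sub: "inversions (delta \<cdot> y) \<subseteq> inversions (delta \<cdot> z)" and ij: "(i, j) \<in> inversions y"
  then have r: "i \<in> {1..n}" "j \<in> {1..n}" using inversions_subset[OF assms(1)] by auto
  then show "(i, j) \<in> inversions z" using sub ij inversions_delta_skip[OF r] by blast
next
  fix i j assume sub: "inversions y \<subseteq> inversions z" and ij: "(i, j) \<in> inversions (delta \<cdot> y)"
  then have r: "i \<in> {1..Suc n}" "j \<in> {1..Suc n}"
    using inversions_subset[OF delta_permutes_rmul[OF assms(1)]] by auto
  show "(i, j) \<in> inversions (delta \<cdot> z)"
  proof (rule skip_cases[OF r(1)])
    assume "i = Suc p"
    then show ?thesis using ij inversions_delta_p(1)[OF assms(1)] inversions_delta_p(1)[OF assms(2)]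
      by simp
  next
    fix i' assume i': "i' \<in> {1..n}" "i = skip i'"
    show ?thesis
    proof (rule skip_cases[OF r(2)])
      assume "j = Suc p"
      then show ?thesis using ij inversions_delta_p(2)[OF assms(1)] by simp
    next
      fix j' assume j': "j' \<in> {1..n}" "j = skip j'"
      show ?thesis using ij sub unfolding i'(2) j'(2) inversions_delta_skip[OF i'(1) j'(1)] by blast
    qed
  qed
qed

lemma Z_permutes: "z \<in> Z lam \<Longrightarrow> z permutes {1..n}"
  by (simp only: Z_iff X_J_iff)

lemma Z'_permutes: "z \<in> Z lam' \<Longrightarrow> z permutes {1..Suc n}"
  by (simp only: Z_iff X_J_iff sum_lam')

lemma delta_inject: "delta \<cdot> y = delta \<cdot> z \<longleftrightarrow> y = z"
proof
  assume eq: "delta \<cdot> y = delta \<cdot> z"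
  show "y = z"
  proof
    fix i
    have "delta (Hilbert_Choice.inv delta i) = i" using permutes_inverses[OF delta_permutes] by simp
    then show "y i = z i" using fun_cong[OF eq, of "Hilbert_Choice.inv delta i"]
      by (simp only: rmul_apply)
  qed
qed simp

text \<open>If the image of \<open>y\<close> is a prefix of \<open>v\<close>, its inversions at
  \<open>Suc p\<close> make \<open>v\<close> dominate there, so \<open>v\<close> takes the value
  \<open>Suc n\<close> there and equals \<open>delta \<cdot> z\<close>. The bound \<open>R\<close>
  puts \<open>z\<close> into \<open>Z lam\<close>, where \<open>y\<close> is maximal.\<close>

lemma Y_delta:
  assumes y: "y \<in> Y lam" and le: "\<forall>l\<in>set ks \<union> set ls. l \<le> m"
    and R: "\<forall>l\<in>set ks. l \<le> R" "R = 0 \<or> (\<exists>l\<in>set ls. R \<le> l)"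
  shows "delta \<cdot> y \<in> Y lam'"
proof -
  have yZ: "y \<in> Z lam" and max: "\<And>z. \<lbrakk>z \<in> Z lam; z \<noteq> y\<rbrakk> \<Longrightarrow> \<not> is_prefix n y z"
    using y by (auto simp: Y_def)
  note yp = Z_permutes[OF yZ]
  have "\<not> is_prefix (Suc n) (delta \<cdot> y) v" if v: "v \<in> Z lam'" "v \<noteq> delta \<cdot> y" for v
  proof
    note vp = Z'_permutes[OF v(1)]
    assume pre: "is_prefix (Suc n) (delta \<cdot> y) v"
    then have sub: "inversions (delta \<cdot> y) \<subseteq> inversions v"
      using is_prefix_iff[OF delta_permutes_rmul[OF yp] vp] by simp
    have "v j < v (Suc p)" if "Suc p < j" "j \<le> Suc n" for j
    proof -
      have "(Suc p, j) \<in> inversions v" using sub inversions_delta_p(1)[OF yp] that by blast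
      then show ?thesis by (simp add: inversions_def)
    qed
    then have "v (Suc p) = Suc n" using Z_last_value[OF v(1)] le by blast
    then obtain z where z: "z permutes {1..n}" "v = delta \<cdot> z" using delta_quotient[OF vp] by blast
    have "z \<in> Z lam" using Z_delta_inverse[OF z(1) _ R] v(1) z(2) by blast
    moreover have "is_prefix n y z" using pre prefix_delta_iff[OF yp z(1)] z(2) by simp
    moreover have "z \<noteq> y" using v(2) z(2) by auto
    ultimately show False using max by blast
  qed
  then show ?thesis using Z_delta[OF yZ] le unfolding Y_def sum_lam' by blast
qed

text \<open>Turning the first letter into \<open>Suc n\<close> stays inside \<open>Z lam'\<close>:
  deleting the first letter leaves canonical growth, and the other letters are relabelled in order.
  The result has \<open>v\<close> as a prefix, so it is \<open>v\<close>; maximality of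
  \<open>y\<close> then follows because any larger \<open>z\<close> would give
  \<open>delta \<cdot> z\<close> above \<open>v\<close>.\<close>

lemma Y_delta_inverse:
  assumes v: "v \<in> Y lam'" and ks: "ks = []" and le: "\<forall>l\<in>set ls. l \<le> m"
  shows "\<exists>y\<in>Y lam. v = delta \<cdot> y"
proof -
  have vZ: "v \<in> Z lam'" and max: "\<And>w. \<lbrakk>w \<in> Z lam'; w \<noteq> v\<rbrakk> \<Longrightarrow> \<not> is_prefix (Suc n) v w"
    using v unfolding Y_def sum_lam' by auto
  have vX: "v \<in> X_J lam'" and gr: "growth (dec_word lam' 0 v) [] = canonical lam'"
    using vZ by (auto simp only: Z_iff)
  note vp = Z'_permutes[OF vZ]
  have inc: "v i < v j" if "1 \<le> i" "i < j" "j \<le> Suc n" "block_of lam' i = block_of lam' j" for i j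
    using vX that unfolding X_J_iff sum_lam' by blast
  have p: "p = m" "q = 0" using ks by auto
  have inj: "v i = v j \<longleftrightarrow> i = j" for i j using permutes_inj[OF vp] by (auto dest: injD)
  define N where "N = v (Suc p)"
  have N: "1 \<le> N" "N \<le> Suc n"
    unfolding N_def using permutes_ge_1[OF vp, of "Suc p"] permutes_le[OF vp, of "Suc p"] by auto
  \<comment> \<open>Raises the first letter \<open>N\<close> to \<open>Suc n\<close> and lowers the
    letters above \<open>N\<close> by one, keeping the order of all the others.\<close>
  define c where "c = cycle_up N n"
  have cp: "c permutes {1..Suc n}" unfolding c_def by (rule cycle_up_permutes[OF N])
  have cN: "c N = Suc n" using N by (simp add: c_def cycle_up_def)
  have c_less: "c x < c y" if "x < y" "y \<le> Suc n" "x \<noteq> N" "y \<noteq> N" for x y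
    unfolding c_def using cycle_up_less that by blast
  have vcp: "v \<cdot> c permutes {1..Suc n}" using vp cp by (rule rmul_permutes)
  have "(v \<cdot> c) (Suc p) = Suc n" using cN N_def by (simp add: rmul_apply)
  then obtain y where y: "y permutes {1..n}" "v \<cdot> c = delta \<cdot> y" using delta_quotient[OF vcp] by blast
  have yskip: "y i = c (v (skip i))" if "i \<le> n" for i
    using fun_cong[OF y(2), of "skip i"] delta_skip[OF that] by (simp only: rmul_apply)
  have skipN: "v (skip i) \<noteq> N" for i unfolding N_def inj by auto
  have "y \<in> X_J lam"
  proof (rule X_J_skip[OF y(1) vX])
    fix i j assume ij: "i \<in> {1..n}" "j \<in> {1..n}" "v (skip i) < v (skip j)"
    then have "v (skip j) \<le> Suc n" by (intro permutes_le[OF vp]) auto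
    then have "c (v (skip i)) < c (v (skip j))" using c_less ij(3) skipN by blast
    then show "y i < y j" using yskip ij by simp
  qed
  moreover have "growth (dec_word lam 0 y) [] = canonical lam"
  proof -
    let ?bs = "rev (map v [Suc q..<Suc p])" and ?ws = "dec_word ls (Suc p) v"
    have w: "dec_word lam' 0 v = N # ?bs @ ?ws" unfolding dec_word_lam' using ks N_def by simp
    have "growth (?bs @ ?ws) [] = canonical (m # ls)"
    proof (rule growth_remove_first)
      show "growth (N # ?bs @ ?ws) [] = canonical (Suc m # ls)" using gr w ks by simp
      show "length ?bs = m" by simp
      have "rev (N # ?bs) = map v [1..<Suc (Suc m)]"
        using ks by (simp add: N_def upt_Suc_append)
      moreover have "sorted_wrt (<) (map v [1..<Suc (Suc m)])"
        unfolding sorted_wrt_map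
      proof (rule sorted_wrt_mono_rel[OF _ sorted_wrt_upt])
        fix i j assume "i \<in> set [1..<Suc (Suc m)]" "j \<in> set [1..<Suc (Suc m)]" "i < j"
        then show "v i < v j" using inc[of i j] ks by auto
      qed
      ultimately show "sorted_wrt (<) (rev (N # ?bs))" by simp
    qed (rule le)
    moreover have "growth (map c (?bs @ ?ws)) [] = growth (?bs @ ?ws) []"
    proof -
      have "strict_mono_on (set (?bs @ ?ws) \<union> set (concat [])) c"
      proof (rule strict_mono_onI)
        fix x y assume xy: "x \<in> set (?bs @ ?ws) \<union> set (concat [])"
          "y \<in> set (?bs @ ?ws) \<union> set (concat [])" "x < y"
        have "z \<le> Suc n \<and> z \<noteq> N" if zin: "z \<in> set (?bs @ ?ws) \<union> set (concat [])" for z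
        proof -
          obtain j where "z = v j" "j \<le> Suc n" "j \<noteq> Suc p"
            using zin by (auto simp: set_dec_word)
          then show ?thesis using permutes_le[OF vp] inj N_def by simp
        qed
        then show "c x < c y" using c_less xy by blast
      qed
      from growth_map[OF this] show ?thesis by simp
    qed
    moreover have "dec_word lam 0 y = map c (?bs @ ?ws)"
    proof -
      have "dec_word lam' 0 (v \<cdot> c) = map c (N # ?bs @ ?ws)"
        unfolding rmul_def dec_word_map w ..
      moreover have "dec_word lam' 0 (delta \<cdot> y) = y (Suc n) # dec_word lam 0 y"
        unfolding dec_word_delta dec_word_lam using ks by simp
      ultimately show ?thesis using y(2) by simp
    qed
    ultimately show ?thesis using ks by simp
  qed
  ultimately have yZ: "y \<in> Z lam" by (simp only: Z_iff)
  have dZ: "delta \<cdot> y \<in> Z lam'" using Z_delta[OF yZ le] .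
  \<comment> \<open>The value \<open>N\<close> ends the first block, where \<open>v\<close>
    increases, so it is never the smaller value of an inversion; making it the largest loses
    none.\<close>
  have "inversions v \<subseteq> inversions (v \<cdot> c)"
  proof (rule subrelI)
    fix i j assume ij: "(i, j) \<in> inversions v"
    then have r: "1 \<le> i" "i \<le> Suc n" "j \<le> Suc n" and lt: "i < j" "v j < v i"
      using inversions_subset[OF vp] by (auto simp: inversions_def)
    have jN: "v j \<noteq> N"
    proof
      assume "v j = N"
      then have "j = Suc m" using N_def inj p by simp
      then show False using inc[of i j] lt r ks by auto
    qed
    have "c (v j) < c (v i)"
    proof (cases "v i = N")
      case True
      have "c (v j) \<le> Suc n" by (intro permutes_le[OF cp] permutes_le[OF vp] r)
      moreover have "c (v j) \<noteq> c N" using permutes_inj[OF cp] jN by (auto dest: injD)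
      ultimately show ?thesis using True cN by simp
    next
      case False
      then show ?thesis using c_less lt(2) jN permutes_le[OF vp r(2)] by blast
    qed
    then show "(i, j) \<in> inversions (v \<cdot> c)" using lt by (simp add: inversions_def rmul_apply)
  qed
  then have "is_prefix (Suc n) v (delta \<cdot> y)" using is_prefix_iff[OF vp vcp] y(2) by simp
  then have eq: "v = delta \<cdot> y" using max[OF dZ] by blast
  have "\<not> is_prefix n y z" if z: "z \<in> Z lam" "z \<noteq> y" for z
  proof
    assume "is_prefix n y z"
    then have "is_prefix (Suc n) v (delta \<cdot> z)"
      using prefix_delta_iff[OF y(1) Z_permutes[OF z(1)]] eq by simp
    moreover have "delta \<cdot> z \<noteq> v" using z(2) eq delta_inject by simp
    ultimately show False using max[OF Z_delta[OF z(1) le]] by blast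
  qed
  then have "y \<in> Y lam" using yZ unfolding Y_def by blast
  then show ?thesis using eq by blast
qed

section \<open>Effect of the increment on diagrams and on cells\<close>

lemma row_of_delta:
  assumes z: "z permutes {1..n}"
  shows "j \<in> {1..n} \<Longrightarrow> row_of lam' (delta \<cdot> z) j = row_of lam z j"
    and "row_of lam' (delta \<cdot> z) (Suc n) = length ks"
proof -
  have inv: "Hilbert_Choice.inv (delta \<cdot> z) ((delta \<cdot> z) i) = i" for i
    using permutes_inverses[OF delta_permutes_rmul[OF z]] by simp
  show "row_of lam' (delta \<cdot> z) (Suc n) = length ks"
  proof -
    have "(delta \<cdot> z) (Suc p) = Suc n" using delta_p permutes_gt[OF z lessI] by (simp add: rmul_apply)
    then have "Hilbert_Choice.inv (delta \<cdot> z) (Suc n) = Suc p" using inv[of "Suc p"] by simp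
    then show ?thesis using block_of_p by (simp only: row_of_def)
  qed
  assume j: "j \<in> {1..n}"
  let ?i = "Hilbert_Choice.inv z j"
  have i: "?i \<in> {1..n}" using permutes_in_image[OF permutes_inv[OF z]] j by simp
  have "z ?i = j" using permutes_inverses[OF z] by simp
  then have "(delta \<cdot> z) (skip ?i) = j" using delta_skip[of ?i] i by (simp add: rmul_apply)
  then have "Hilbert_Choice.inv (delta \<cdot> z) j = skip ?i" using inv[of "skip ?i"] by simp
  then show "row_of lam' (delta \<cdot> z) j = row_of lam z j"
    using block_of_skip[of ?i] i by (simp add: row_of_def)
qed

abbreviation "cols z \<equiv> min_cols (row_of lam z)"
abbreviation "cols' z \<equiv> \<lambda>j. if j \<le> n then cols z j else Suc (cols z n)"

text \<open>The added node is alone in the last column, so its column number is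
  \<open>Suc n\<close>, while the old nodes keep their rows, columns and numbers.\<close>

lemma extend_min_diagram:
  assumes comp: "0 \<notin> set lam" and z: "z \<in> X_J lam"
  shows "extend_diagram (Suc (length ks)) (min_diagram z lam) = diagram_of lam' (delta \<cdot> z) (cols' z)"
proof -
  have zp: "z permutes {1..n}" using z by (simp only: X_J_iff)
  have "m \<noteq> 0" using comp by auto
  then have n: "1 \<le> n" by simp
  have "num_cols (diagram_of lam z (cols z)) = cols z n"
    by (rule valid_diagram(3)[OF comp z valid_cols_min_cols])
  then have "extend_diagram (Suc (length ks)) (min_diagram z lam) =
      insert (Suc (length ks), Suc (cols z n)) (diagram_of lam z (cols z))"
    unfolding min_diagram_eq[OF comp z n] extend_diagram_def by simp
  also have "diagram_of lam z (cols z) =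
      (\<lambda>j. (Suc (row_of lam' (delta \<cdot> z) j), cols' z j)) ` {1..n}"
    unfolding diagram_of_def using row_of_delta(1)[OF zp] by (intro image_cong) auto
  also have "insert (Suc (length ks), Suc (cols z n)) \<dots> = diagram_of lam' (delta \<cdot> z) (cols' z)"
  proof -
    have "{1..Suc n} = insert (Suc n) {1..n}" by auto
    then show ?thesis unfolding diagram_of_def sum_lam' using row_of_delta(2)[OF zp] by simp
  qed
  finally show ?thesis .
qed

lemma valid_cols_delta:
  assumes z: "z permutes {1..n}"
  shows "valid_cols (row_of lam' (delta \<cdot> z)) (Suc n) (cols' z) (Suc (cols z n))"
proof -
  have v: "valid_cols (row_of lam z) n (cols z) (cols z n)" by (rule valid_cols_min_cols)
  have "cols' z ` {1..n} = cols z ` {1..n}" by (rule image_cong) auto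
  also have "\<dots> = {1..cols z n}" using v by (simp add: valid_cols_def)
  finally have im: "cols' z ` {1..n} = {1..cols z n}" .
  have "cols' z ` {1..Suc n} = {1..Suc (cols z n)}"
  proof -
    have "{1..Suc n} = insert (Suc n) {1..n}" by auto
    then have "cols' z ` {1..Suc n} = insert (cols' z (Suc n)) {1..cols z n}"
      by (simp only: image_insert im)
    then show ?thesis by auto
  qed
  moreover have "cols' z j < cols' z j' \<or>
      cols' z j = cols' z j' \<and> row_of lam' (delta \<cdot> z) j < row_of lam' (delta \<cdot> z) j'"
    if j: "1 \<le> j" "j < j'" "j' \<le> Suc n" for j j'
  proof (cases "j' = Suc n")
    case True
    then show ?thesis using valid_cols_mono[OF v, of j n] j by auto
  next
    case False
    then have j': "j' \<le> n" using j by simp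
    then have "cols z j < cols z j' \<or> cols z j = cols z j' \<and> row_of lam z j < row_of lam z j'"
      using v j by (simp add: valid_cols_def)
    then show ?thesis using row_of_delta(1)[OF z, of j] row_of_delta(1)[OF z, of j'] j j' by simp
  qed
  ultimately show ?thesis unfolding valid_cols_def by blast
qed

lemma comp_lam': "0 \<notin> set lam \<Longrightarrow> 0 \<notin> set lam'"
  by auto

lemma w_diag_extend:
  assumes comp: "0 \<notin> set lam" and z: "z \<in> X_J lam"
  shows "w_diag (extend_diagram (Suc (length ks)) (min_diagram z lam)) = delta \<cdot> z"
proof -
  have "z permutes {1..n}" using z by (simp only: X_J_iff)
  from valid_cols_delta[OF this] have
    "valid_cols (row_of lam' (delta \<cdot> z)) (sum_list lam') (cols' z) (Suc (cols z n))"
    unfolding sum_lam' .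
  from valid_diagram(2)[OF comp_lam'[OF comp] X_J_delta[OF z] this]
  show ?thesis unfolding extend_min_diagram[OF comp z] .
qed

text \<open>Adding a last column keeps the number of columns minimal when the new node lies in the
  first row, because the greedy rule cannot place it in an old column.\<close>

lemma min_diagram_delta:
  assumes comp: "0 \<notin> set lam" and z: "z \<in> X_J lam" and ks: "ks = []"
  shows "min_diagram (delta \<cdot> z) lam' = extend_diagram (Suc (length ks)) (min_diagram z lam)"
proof -
  have zp: "z permutes {1..n}" using z by (simp only: X_J_iff)
  let ?b' = "row_of lam' (delta \<cdot> z)"
  have eq: "min_cols ?b' j = cols z j" if "j \<le> n" for j
    using that
  proof (induction j)
    case (Suc j)
    then show ?case using row_of_delta(1)[OF zp, of j] row_of_delta(1)[OF zp, of "Suc j"]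
      by (cases "j = 0") auto
  qed simp
  \<comment> \<open>Rows are 0-based here and none precedes row 0, so the test for staying in the
    column of the value before fails.\<close>
  have "?b' (Suc n) = 0" using row_of_delta(2)[OF zp] ks by simp
  then have "min_cols ?b' (Suc n) = Suc (cols z n)" using eq[of n] by simp
  then have "min_cols ?b' j = cols' z j" if "j \<in> {1..Suc n}" for j
    using eq[of j] that by (cases "j = Suc n") auto
  then have "diagram_of lam' (delta \<cdot> z) (min_cols ?b') = diagram_of lam' (delta \<cdot> z) (cols' z)"
    unfolding diagram_of_def sum_lam' by (intro image_cong) auto
  moreover have "min_diagram (delta \<cdot> z) lam' = diagram_of lam' (delta \<cdot> z) (min_cols ?b')"
    by (rule min_diagram_eq[OF comp_lam'[OF comp] X_J_delta[OF z]]) simp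
  ultimately show ?thesis unfolding extend_min_diagram[OF comp z] by simp
qed

text \<open>Both sides have the row-form of \<open>w_J lam \<cdot> z\<close> with
  \<open>Suc n\<close> inserted as entry \<open>Suc q\<close>: the cycle puts it in front of the
  block directly, whereas \<open>delta\<close> puts it at the end and \<open>w_J lam'\<close>
  reverses the block.\<close>

lemma cycle_up_w_J:
  assumes z: "z permutes {1..n}"
  shows "cycle_up (Suc q) n \<cdot> (w_J lam \<cdot> z) = w_J lam' \<cdot> (delta \<cdot> z)"
proof -
  let ?f = "w_J lam \<cdot> z" and ?l = "cycle_up (Suc q) n \<cdot> (w_J lam \<cdot> z)"
  let ?r = "w_J lam' \<cdot> (delta \<cdot> z)"
  have fp: "?f permutes {1..n}"
    unfolding w_J_eq by (rule rmul_permutes[OF rev_blocks_permutes z])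
  have lp: "?l permutes {1..Suc n}"
    by (rule rmul_permutes[OF cycle_up_permutes permutes_Suc[OF fp]]) auto
  have rp: "?r permutes {1..Suc n}"
    unfolding w_J_eq
    by (rule rmul_permutes[OF _ delta_permutes_rmul[OF z]]) (use rev_blocks_permutes[of lam'] in simp)
  have "row_form n ?f = map ?f [1..<Suc q] @ map ?f [Suc q..<Suc n]"
    unfolding row_form_def map_append[symmetric] using upt_add_eq_append[of 1 "Suc q" "n - q"] by simp
  then have "map ?f [1..<Suc q] @ map ?f [Suc q..<Suc n] =
      dec_word ks 0 z @ rev (map z [Suc q..<Suc p]) @ dec_word ls p z"
    using row_form_w_J[of lam z] unfolding dec_word_lam by simp
  then have f: "map ?f [1..<Suc q] = dec_word ks 0 z"
      "map ?f [Suc q..<Suc n] = rev (map z [Suc q..<Suc p]) @ dec_word ls p z"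
    by (auto simp only: append_eq_append_conv length_map length_upt length_dec_word diff_Suc_1
        disjI1 simp_thms One_nat_def diff_Suc_Suc diff_zero)
  have "row_form (Suc n) ?l = map ?l [1..<Suc q] @ map ?l [Suc q..<Suc (Suc n)]"
    unfolding row_form_def map_append[symmetric] using upt_add_eq_append[of 1 "Suc q" "Suc n - q"] by simp
  also have "map ?l [1..<Suc q] = map ?f [1..<Suc q]"
    by (rule map_cong) (auto simp: rmul_apply cycle_up_def)
  also have "map ?l [Suc q..<Suc (Suc n)] = ?f (Suc n) # map ?f [Suc q..<Suc n]"
    by (rule nth_equalityI) (auto simp: rmul_apply cycle_up_def nth_Cons split: nat.splits)
  also have "?f (Suc n) = Suc n" by (rule permutes_gt[OF fp lessI])
  finally have "row_form (Suc n) ?l = row_form (Suc n) ?r"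
    using row_form_w_J[of lam' "delta \<cdot> z"]
    unfolding f dec_word_delta sum_lam' permutes_gt[OF z lessI] by simp
  then have eq: "?l i = ?r i" if "i \<in> {1..Suc n}" for i
    using that unfolding row_form_def by (auto simp: map_eq_conv)
  show ?thesis
  proof
    fix i
    show "?l i = ?r i"
      by (cases "i \<in> {1..Suc n}") (use eq lp rp permutes_not_in in metis)+
  qed
qed

end

section \<open>The three sufficient conditions and the assembly of all claims\<close>

lemma sum_nth_eq_sum_list_take:
  "k \<le> length lam \<Longrightarrow> (\<Sum>i = 1..k. lam ! (i - 1)) = sum_list (take k lam)" for lam :: "nat list"
  by (induction k) (auto simp: take_Suc_conv_app_nth)

text \<open>Take \<open>R = 0\<close> if no part precedes the \<open>k\<close>-th, the largest part
  if it occurs again after the \<open>k\<close>-th, and otherwise the largest of the other parts,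
  whose last occurrence comes after the \<open>k\<close>-th.\<close>

lemma insertion_bound:
  assumes k: "k \<in> M lam"
    and cond: "k = 1
        \<or> k \<noteq> Max (M lam)
        \<or> (M lam = {k}
            \<and> Max {i. 1 \<le> i \<and> i \<le> length lam \<and>
                 lam ! (i - 1) = Max {lam ! (j - 1) | j. 1 \<le> j \<and> j \<le> length lam \<and> j \<noteq> k}} > k)"
  shows "\<exists>R. (\<forall>l\<in>set (take (k - 1) lam). l \<le> R) \<and> (R = 0 \<or> (\<exists>l\<in>set (drop k lam). R \<le> l))"
proof -
  have k1: "1 \<le> k" "k \<le> length lam" "lam ! (k - 1) = Max (set lam)" using k by (auto simp: M_def)
  have before: "\<exists>j. 1 \<le> j \<and> j < k \<and> l = lam ! (j - 1)" if l: "l \<in> set (take (k - 1) lam)" for l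
  proof -
    obtain i where "i < length (take (k - 1) lam)" "l = take (k - 1) lam ! i"
      using l by (metis in_set_conv_nth)
    then have "i < k - 1" "l = lam ! i" by auto
    then show ?thesis by (intro exI[of _ "Suc i"]) auto
  qed
  have after: "lam ! (j - 1) \<in> set (drop k lam)" if "k < j" "j \<le> length lam" for j
  proof -
    have "drop k lam ! (j - 1 - k) = lam ! (j - 1)" using that by simp
    moreover have "j - 1 - k < length (drop k lam)" using that by simp
    ultimately show ?thesis by (metis nth_mem)
  qed
  show ?thesis
    using cond
  proof (elim disjE)
    assume "k = 1"
    then show ?thesis by (intro exI[of _ 0]) simp
  next
    assume ne: "k \<noteq> Max (M lam)"
    have fin: "finite (M lam)" by (rule finite_subset[of _ "{..length lam}"]) (auto simp: M_def)
    then have "Max (M lam) \<in> M lam" "k \<le> Max (M lam)" using k by (auto intro: Max_in)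
    then have "Max (set lam) \<in> set (drop k lam)"
      using after[of "Max (M lam)"] ne by (auto simp: M_def)
    moreover have "l \<le> Max (set lam)" if "l \<in> set (take (k - 1) lam)" for l
      using that by (meson List.finite_set Max_ge in_set_takeD)
    ultimately show ?thesis by (intro exI[of _ "Max (set lam)"]) auto
  next
    let ?S = "{lam ! (j - 1) | j. 1 \<le> j \<and> j \<le> length lam \<and> j \<noteq> k}"
    let ?I = "{i. 1 \<le> i \<and> i \<le> length lam \<and> lam ! (i - 1) = Max ?S}"
    assume c: "M lam = {k} \<and> Max ?I > k"
    show ?thesis
    proof (cases "take (k - 1) lam = []")
      case True
      show ?thesis unfolding True by (intro exI[of _ 0]) simp
    next
      case False
      have "?S = (\<lambda>j. lam ! (j - 1)) ` {j. 1 \<le> j \<and> j \<le> length lam \<and> j \<noteq> k}" by blast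
      then have fin: "finite ?S" by simp
      have le: "l \<le> Max ?S" if l: "l \<in> set (take (k - 1) lam)" for l
      proof (rule Max_ge[OF fin])
        obtain j where "1 \<le> j" "j < k" "l = lam ! (j - 1)" using before[OF l] by blast
        then show "l \<in> ?S" using k1 by force
      qed
      \<comment> \<open>Some part precedes the \<open>k\<close>-th, so the first part shows that
        \<open>?S\<close> is nonempty and its maximum is attained.\<close>
      have "1 < k" using False by (cases "k \<le> 1") auto
      then have "lam ! (1 - 1) \<in> ?S" using k1 by force
      then have "Max ?S \<in> ?S" using fin by (intro Max_in) auto
      then have "?I \<noteq> {}" by force
      moreover have "finite ?I" by (rule finite_subset[of _ "{..length lam}"]) auto
      ultimately have "Max ?I \<in> ?I" by (rule Max_in[rotated])
      then have "Max ?S \<in> set (drop k lam)" using after[of "Max ?I"] c by auto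
      then show ?thesis using le by (intro exI[of _ "Max ?S"]) auto
    qed
  qed
qed

theorem theorem4p8:
  fixes n k p q :: nat and lam lam' :: "nat list" and d d' :: "nat \<Rightarrow> nat"
    and \<theta> :: "(nat \<Rightarrow> nat) \<Rightarrow> nat \<Rightarrow> nat"
  assumes "composition_of lam n"
    and "k \<in> M lam"
    and "lam' = inc_part lam k"
    and "p = (\<Sum>i = 1..k. lam ! (i - 1))"
    and "q = (\<Sum>i = 1..k - 1. lam ! (i - 1))"
    and "d = word_prod [p + 1..<n + 1]"
    and "d' = word_prod [q + 1..<n + 1]"
    and "\<theta> = theta lam k"
  shows "\<theta> \<in> Z lam \<rightarrow> Z lam'
    \<and> (\<forall>z\<in>Z lam. \<theta> z = d \<cdot> z) \<and> inj_on \<theta> (Z lam)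
    \<and> (\<lambda>x. d' \<cdot> x) ` C_cell lam \<subseteq> C_cell lam'
    \<and> (k = 1
        \<or> k \<noteq> Max (M lam)
        \<or> (M lam = {k}
            \<and> Max {i. 1 \<le> i \<and> i \<le> length lam \<and>
                 lam ! (i - 1) = Max {lam ! (j - 1) | j. 1 \<le> j \<and> j \<le> length lam \<and> j \<noteq> k}} > k)
       \<longrightarrow> \<theta> ` Y lam \<subseteq> Y lam')
    \<and> (k = 1 \<longrightarrow>
         \<theta> ` Y lam = Y lam'
         \<and> bij_betw (extend_diagram k) (E_diagrams lam) (E_diagrams lam')
         \<and> (\<forall>y\<in>Y lam. min_diagram (\<theta> y) lam' = extend_diagram k (min_diagram y lam)))"
proof -
  define ks where "ks = take (k - 1) lam"
  define m where "m = lam ! (k - 1)"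
  define ls where "ls = drop k lam"
  have k: "1 \<le> k" "k \<le> length lam" "m = Max (set lam)"
    using assms(2) by (auto simp: M_def m_def)
  then have km: "k - 1 < length lam" "Suc (k - 1) = k" by auto
  have lam: "lam = ks @ m # ls"
    unfolding ks_def m_def ls_def using id_take_nth_drop[OF km(1)] km(2) by simp
  have lam': "lam' = ks @ Suc m # ls"
    unfolding assms(3) inc_part_def ks_def m_def ls_def
    using upd_conv_take_nth_drop[OF km(1)] km(2) by simp
  have len: "Suc (length ks) = k" using k by (simp add: ks_def)
  have comp: "0 \<notin> set lam" and n: "n = sum_list lam"
    using assms(1) by (auto simp: composition_of_def)
  have le: "\<forall>l\<in>set ks \<union> set ls. l \<le> m" unfolding k(3) using lam by auto
  have q: "q = sum_list ks" unfolding assms(5) ks_def by (rule sum_nth_eq_sum_list_take) (use k in auto)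
  have p: "p = sum_list ks + m"
  proof -
    have "p = sum_list (take k lam)" unfolding assms(4) by (rule sum_nth_eq_sum_list_take[OF k(2)])
    also have "take k lam = ks @ [m]"
      using take_Suc_conv_app_nth[OF km(1)] km(2) by (simp add: ks_def m_def)
    finally show ?thesis by simp
  qed
  interpret incremented_part ks ls m .
  have d: "d = cycle_up (Suc p) n"
    unfolding assms(6) using word_prod_upt[of "Suc p" n] p n lam by simp
  have d': "d' = cycle_up (Suc q) n"
    unfolding assms(7) using word_prod_upt[of "Suc q" n] q n lam by simp
  have "cycle_up (Suc (sum_list ks + m)) (sum_list lam) = d"
      "cycle_up (Suc (sum_list ks)) (sum_list lam) = d'"
    using d d' p q n by simp_all
  \<comment> \<open>Folds the expressions of the locale back into \<open>lam\<close>,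
    \<open>lam'\<close>, \<open>d\<close>, \<open>d'\<close> and \<open>k\<close>.\<close>
  note loc = lam[symmetric] lam'[symmetric] this len
  have X: "z \<in> X_J lam" if "z \<in> Z lam" for z using that by (simp add: Z_iff)
  have theta: "\<theta> z = d \<cdot> z" if "z \<in> Z lam" for z
    unfolding assms(8) theta_def
    using w_diag_extend[unfolded loc, OF comp X[OF that]] .
  have Zd: "d \<cdot> z \<in> Z lam'" if "z \<in> Z lam" for z
    by (rule Z_delta[unfolded loc, OF that]) (use le in blast)
  have inj: "inj_on \<theta> (Z lam)"
    using delta_inject[unfolded loc] by (intro inj_onI) (simp add: theta)
  have cell: "(\<lambda>x. d' \<cdot> x) ` C_cell lam \<subseteq> C_cell lam'"
  proof (rule image_subsetI)
    fix x assume "x \<in> C_cell lam"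
    then obtain z where z: "z \<in> Z lam" "x = w_J lam \<cdot> z" by (auto simp: C_cell_def)
    have "z permutes {1..sum_list lam}" by (rule Z_permutes[unfolded loc, OF z(1)])
    from cycle_up_w_J[unfolded loc, OF this] have "d' \<cdot> x = w_J lam' \<cdot> (d \<cdot> z)"
      unfolding z(2) .
    then show "d' \<cdot> x \<in> C_cell lam'" using Zd[OF z(1)] by (auto simp: C_cell_def)
  qed
  have YZ: "y \<in> Z lam" if "y \<in> Y lam" for y using that by (simp add: Y_def)
  have Ysub: "\<theta> ` Y lam \<subseteq> Y lam'" if cond: "k = 1
        \<or> k \<noteq> Max (M lam)
        \<or> (M lam = {k}
            \<and> Max {i. 1 \<le> i \<and> i \<le> length lam \<and>
                 lam ! (i - 1) = Max {lam ! (j - 1) | j. 1 \<le> j \<and> j \<le> length lam \<and> j \<noteq> k}} > k)"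
  proof -
    obtain R where R: "\<forall>l\<in>set ks. l \<le> R" "R = 0 \<or> (\<exists>l\<in>set ls. R \<le> l)"
      using insertion_bound[OF assms(2) cond] unfolding ks_def ls_def by blast
    show ?thesis
    proof (rule image_subsetI)
      fix y assume y: "y \<in> Y lam"
      show "\<theta> y \<in> Y lam'"
        unfolding theta[OF YZ[OF y]] by (rule Y_delta[unfolded loc, OF y le R])
    qed
  qed
  have first: "\<theta> ` Y lam = Y lam'
      \<and> bij_betw (extend_diagram k) (E_diagrams lam) (E_diagrams lam')
      \<and> (\<forall>y\<in>Y lam. min_diagram (\<theta> y) lam' = extend_diagram k (min_diagram y lam))" if "k = 1"
  proof -
    have ks: "ks = []" using that by (simp add: ks_def)
    have "v \<in> \<theta> ` Y lam" if v: "v \<in> Y lam'" for v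
    proof -
      obtain y where y: "y \<in> Y lam" "v = d \<cdot> y"
        using Y_delta_inverse[unfolded loc, OF v ks] le by blast
      then have "v = \<theta> y" using theta[OF YZ[OF y(1)]] by simp
      then show ?thesis using y(1) by (rule image_eqI)
    qed
    then have "Y lam' \<subseteq> \<theta> ` Y lam" by (rule subsetI)
    with Ysub[OF disjI1[OF that]] have img: "\<theta> ` Y lam = Y lam'" by (rule subset_antisym)
    have min: "min_diagram (\<theta> y) lam' = extend_diagram k (min_diagram y lam)" if y: "y \<in> Y lam" for y
      unfolding theta[OF YZ[OF y]]
      by (rule min_diagram_delta[unfolded loc, OF comp X[OF YZ[OF y]] ks])
    have "inj_on (extend_diagram k) (E_diagrams lam)"
    proof (rule inj_onI)
      fix D D' assume D: "D \<in> E_diagrams lam" "D' \<in> E_diagrams lam"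
        and eq: "extend_diagram k D = extend_diagram k D'"
      then obtain y y' where y: "y \<in> Y lam" "D = min_diagram y lam" "y' \<in> Y lam" "D' = min_diagram y' lam"
        by (auto simp: E_diagrams_def)
      \<comment> \<open>The value of \<open>\<theta>\<close> is read off from the extended diagram,
        so injectivity of the extension reduces to that of \<open>\<theta>\<close>.\<close>
      then have "\<theta> y = \<theta> y'" using eq by (simp add: assms(8) theta_def)
      then show "D = D'" using inj y YZ by (metis inj_onD)
    qed
    moreover have "extend_diagram k ` E_diagrams lam = E_diagrams lam'"
      unfolding E_diagrams_def img[symmetric] image_image using min by (intro image_cong) auto
    ultimately show ?thesis using img min by (simp add: bij_betw_def)
  qed
  have "\<theta> \<in> Z lam \<rightarrow> Z lam'" by (rule Pi_I) (simp add: theta Zd)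
  moreover have "\<forall>z\<in>Z lam. \<theta> z = d \<cdot> z" using theta by (rule ballI)
  ultimately show ?thesis using inj cell impI[OF Ysub] impI[OF first] by (intro conjI)
qed

end
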